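(* Let $\mathcal{H}$ be a complex Hilbert space, $E,F$ real orthogonal projections on $\mathcal{H}$, and $V(t)=e^{itQ}$ a unitary one-parameter group whose selfadjoint generator satisfies $Q\ge m\cdot1$ for some $m>0$. If there exists $\delta>0$ such that $E\le V(t)F'V(t)^*$ for all $t\in[-\delta,\delta]$, then (a) $\|EF\|\le e^{-m\delta}$; (b) $E\wedge F=0$; (c) $\|E+F-E\vee F\|\le e^{-m\delta}$.
   Context: Real orthogonal projections are real linear idempotents selfadjoint with respect to $\mathrm{Re}\langle\cdot,\cdot\rangle$, i.e. projections onto closed real subspaces. $E\le F$ means $E\mathcal{H}\subset F\mathcal{H}$. $F'=1+iFi$ is the projection onto the symplectic complement $\{\xi:\mathrm{Im}\langle\xi,h\rangle=0\ \forall h\in F\mathcal{H}\}$. $E\wedge F$ is the projection onto $E\mathcal{H}\cap F\mathcal{H}$ and $E\vee F$ the projection onto the closed real span of $E\mathcal{H}\cup F\mathcal{H}$. *)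

theory Defs
  imports "HOL-Analysis.Analysis"
begin

text \<open>A complex Hilbert space is modelled as a real Hilbert space (type class
  real_inner + complete_space, with inner product = Re of the complex one)
  together with a complex structure J (multiplication by the imaginary unit i):
  a real-linear map with J (J x) = - x preserving the real inner product.\<close>

definition complex_structure :: "('a::real_inner \<Rightarrow> 'a) \<Rightarrow> bool" where
  "complex_structure J \<longleftrightarrow> bounded_linear J \<and> (\<forall>x. J (J x) = - x)
     \<and> (\<forall>x y. inner (J x) (J y) = inner x y)"

definition real_proj :: "('a::real_inner \<Rightarrow> 'a) \<Rightarrow> bool" where
  "real_proj E \<longleftrightarrow> bounded_linear E \<and> (\<forall>x. E (E x) = E x)
     \<and> (\<forall>x y. inner (E x) y = inner x (E y))"

definition proj_le :: "('a \<Rightarrow> 'a) \<Rightarrow> ('a \<Rightarrow> 'a) \<Rightarrow> bool" where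
  "proj_le E F \<longleftrightarrow> range E \<subseteq> range F"

definition sympl_compl :: "('a::real_vector \<Rightarrow> 'a) \<Rightarrow> ('a \<Rightarrow> 'a) \<Rightarrow> ('a \<Rightarrow> 'a)" where
  "sympl_compl J F = (\<lambda>x. x + J (F (J x)))"

definition proj_onto :: "'a::real_inner set \<Rightarrow> ('a \<Rightarrow> 'a)" where
  "proj_onto S = (THE P. real_proj P \<and> range P = S)"

definition proj_meet :: "('a::real_inner \<Rightarrow> 'a) \<Rightarrow> ('a \<Rightarrow> 'a) \<Rightarrow> ('a \<Rightarrow> 'a)" where
  "proj_meet E F = proj_onto (range E \<inter> range F)"

definition proj_join :: "('a::real_inner \<Rightarrow> 'a) \<Rightarrow> ('a \<Rightarrow> 'a) \<Rightarrow> ('a \<Rightarrow> 'a)" where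
  "proj_join E F = proj_onto (closure (span (range E \<union> range F)))"

definition unitary_group :: "('a::real_inner \<Rightarrow> 'a) \<Rightarrow> (real \<Rightarrow> 'a \<Rightarrow> 'a) \<Rightarrow> bool" where
  "unitary_group J V \<longleftrightarrow>
     (\<forall>t. bounded_linear (V t) \<and> surj (V t) \<and> (\<forall>x. norm (V t x) = norm x)
          \<and> (\<forall>x. V t (J x) = J (V t x)))
   \<and> V 0 = id \<and> (\<forall>s t. V (s + t) = V s \<circ> V t)
   \<and> (\<forall>x. continuous_on UNIV (\<lambda>t. V t x))"

text \<open>The generator Q of V(t) = e^{itQ} satisfies Q \<ge> m: for x in the domain
  (where t \<mapsto> V t x is differentiable at 0 with derivative d = iQx),
  Re<x, Qx> \<ge> m |x|^2, with Qx = -i d.\<close>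
definition generator_bounded_below :: "('a::real_inner \<Rightarrow> 'a) \<Rightarrow> (real \<Rightarrow> 'a \<Rightarrow> 'a) \<Rightarrow> real \<Rightarrow> bool" where
  "generator_bounded_below J V m \<longleftrightarrow>
     (\<forall>x d. ((\<lambda>t. V t x) has_vector_derivative d) (at 0) \<longrightarrow>
            m * (norm x)\<^sup>2 \<le> inner x (- J d))"

end

theory Submission
  imports Defs "HOL-Complex_Analysis.Complex_Analysis"
begin

text \<open>For \<open>x\<close> in the range of \<open>E\<close> and \<open>y\<close> in the range of \<open>F\<close> the function \<open>f t = \<langle>x, V t y\<rangle>\<close> is real on
  \<open>[-\<delta>, \<delta>]\<close> and, since \<open>Q \<ge> m\<close>, extends to the upper half plane with
  \<open>\<bar>f z\<bar> \<le> exp (- m Im z) \<parallel>x\<parallel> \<parallel>y\<parallel>\<close>. By Schwarz reflection it is holomorphic off the two slits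
  \<open>\<bar>t\<bar> \<ge> \<delta>\<close>, and comparing \<open>log \<bar>f\<bar>\<close> with \<open>- m Re (sqrt (\<delta>\<^sup>2 - z\<^sup>2))\<close> at \<open>z = 0\<close> gives
  \<open>\<bar>\<langle>x, y\<rangle>\<bar> \<le> exp (- m \<delta>) \<parallel>x\<parallel> \<parallel>y\<parallel>\<close>. All three claims are consequences of this bound on the angle
  between the two ranges.

  The extension is obtained without the spectral theorem: Gaussian mollification makes the orbit
  entire up to a small boundary error, and \<open>Q \<ge> m\<close> turns into the energy estimate
  \<open>d/ds \<parallel>Y (t + i s)\<parallel>\<^sup>2 \<le> - 2 m \<parallel>Y (t + i s)\<parallel>\<^sup>2\<close> up to that error, which bounds the mollified
  orbits and shows that they converge uniformly.\<close>

section \<open>Real orthogonal projections\<close>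

lemma real_projD:
  assumes "real_proj E"
  shows "bounded_linear E" and "E (E x) = E x" and "inner (E x) y = inner x (E y)"
  using assms by (auto simp: real_proj_def)

lemma real_proj_inner_self:
  assumes "real_proj E"
  shows "inner (E x) x = (norm (E x))\<^sup>2"
  using real_projD[OF assms] by (metis power2_norm_eq_inner)

lemma real_proj_norm_le:
  assumes "real_proj E"
  shows "norm (E x) \<le> norm x"
proof (cases "E x = 0")
  case False
  have "(norm (E x))\<^sup>2 \<le> norm (E x) * norm x"
    using real_proj_inner_self[OF assms, of x] norm_cauchy_schwarz[of "E x" x] by simp
  then show ?thesis using False by (simp add: power2_eq_square)
qed simp

lemma real_proj_pythagoras:
  assumes "real_proj E"
  shows "(norm x)\<^sup>2 = (norm (E x))\<^sup>2 + (norm (x - E x))\<^sup>2"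
  using real_proj_inner_self[OF assms, of x]
  by (simp add: power2_norm_eq_inner inner_diff_left inner_diff_right inner_commute)

lemma real_proj_fixes:
  assumes "real_proj E" "x \<in> range E"
  shows "E x = x"
  using assms real_projD(2) by fastforce

text \<open>Each projection fixes the range of the other, and moving \<open>E\<close> and
  \<open>F\<close> across the inner product then identifies them. This makes the \<open>THE\<close>
  in \<open>proj_onto\<close> well determined.\<close>

lemma real_proj_unique:
  assumes E: "real_proj E" and F: "real_proj F" and "range E = range F"
  shows "E = F"
proof
  fix x
  have 1: "E (F x) = F x" "F (E x) = E x"
    using assms real_proj_fixes by blast+
  have "inner (E x) y = inner (F x) y" for y
  proof -
    have "inner (E x) y = inner x (E y)" using real_projD(3)[OF E] .
    also have "\<dots> = inner x (F (E y))" using assms real_proj_fixes by (metis rangeI)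
    also have "\<dots> = inner (E (F x)) y" using real_projD(3)[OF F] real_projD(3)[OF E] by metis
    finally show ?thesis using 1 by simp
  qed
  then show "E x = F x"
    using vector_eq_rdot[of "E x" "F x"] by simp
qed

lemma proj_onto_eqI:
  assumes "real_proj P" "range P = S"
  shows "proj_onto S = P"
  unfolding proj_onto_def using assms real_proj_unique by (intro the_equality) blast+

section \<open>Orthogonal projection onto a closed subspace\<close>

lemma subspace_closure:
  fixes S :: "'a::real_normed_vector set"
  assumes S: "subspace S"
  shows "subspace (closure S)"
proof (rule subspaceI)
  show "0 \<in> closure S" using subspace_0[OF S] closure_subset by blast
next
  fix x y assume "x \<in> closure S" "y \<in> closure S"
  then obtain X Y where "\<And>n. X n \<in> S" "X \<longlonglongrightarrow> x" "\<And>n. Y n \<in> S" "Y \<longlonglongrightarrow> y"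
    unfolding closure_sequential by blast
  then have "(\<forall>n. X n + Y n \<in> S) \<and> (\<lambda>n. X n + Y n) \<longlonglongrightarrow> x + y"
    using S by (simp add: subspace_add tendsto_add)
  then show "x + y \<in> closure S" unfolding closure_sequential by (intro exI)
next
  fix c x assume "x \<in> closure S"
  then obtain X where "\<And>n. X n \<in> S" "X \<longlonglongrightarrow> x"
    unfolding closure_sequential by blast
  then have "(\<forall>n. c *\<^sub>R X n \<in> S) \<and> (\<lambda>n. c *\<^sub>R X n) \<longlonglongrightarrow> c *\<^sub>R x"
    using S by (simp add: subspace_scale tendsto_scaleR)
  then show "c *\<^sub>R x \<in> closure S" unfolding closure_sequential by (intro exI)
qed

text \<open>A minimizing sequence is Cauchy: midpoints stay in \<open>S\<close>, hence at distance
  at least the infimum \<open>d\<close> from \<open>x\<close>, and the parallelogram law turns this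
  into a bound on \<open>Z i - Z j\<close>.\<close>

lemma subspace_best_approximation_exists:
  fixes S :: "'a::{real_inner,complete_space} set"
  assumes S: "subspace S" "closed S"
  shows "\<exists>y\<in>S. \<forall>z\<in>S. norm (x - y) \<le> norm (x - z)"
proof -
  define d where "d = (INF z\<in>S. norm (x - z))"
  have bdd: "bdd_below ((\<lambda>z. norm (x - z)) ` S)"
    by (rule bdd_belowI2[of _ 0]) simp
  have ne: "S \<noteq> {}" using S(1) subspace_0 by blast
  have d_le: "d \<le> norm (x - z)" if "z \<in> S" for z
    unfolding d_def using bdd that by (rule cINF_lower)
  have d0: "0 \<le> d"
    unfolding d_def using ne by (intro cINF_greatest) auto
  have "\<exists>z\<in>S. norm (x - z) < d + inverse (real (Suc n))" for n
    using cINF_less_iff[OF ne bdd, of "d + inverse (real (Suc n))"] unfolding d_def by simp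
  then obtain Z where Z: "\<And>n. Z n \<in> S" "\<And>n. norm (x - Z n) < d + inverse (real (Suc n))"
    by metis
  have par: "(norm (Z i - Z j))\<^sup>2 \<le> 2 * (norm (x - Z i))\<^sup>2 + 2 * (norm (x - Z j))\<^sup>2 - 4 * d\<^sup>2" for i j
  proof -
    have mid: "(1/2) *\<^sub>R (Z i + Z j) \<in> S"
      using S(1) Z(1) by (simp add: subspace_add subspace_scale)
    have "d\<^sup>2 \<le> (norm (x - (1/2) *\<^sub>R (Z i + Z j)))\<^sup>2"
      using d_le[OF mid] d0 by (rule power_mono)
    moreover have "4 * (norm (x - (1/2) *\<^sub>R (Z i + Z j)))\<^sup>2 + (norm (Z i - Z j))\<^sup>2
        = 2 * (norm (x - Z i))\<^sup>2 + 2 * (norm (x - Z j))\<^sup>2"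
      by (simp add: power2_norm_eq_inner inner_diff_left inner_diff_right inner_add_left
          inner_add_right inner_commute algebra_simps)
    ultimately show ?thesis by linarith
  qed
  \<comment> \<open>The excess over \<open>d\<^sup>2\<close>. By \<open>par\<close> the squared
    distance of two terms is at most \<open>2 * e i + 2 * e j\<close>, which explains the threshold
    \<open>\<epsilon>\<^sup>2 / 4\<close> below.\<close>
  define e where "e = (\<lambda>n. (d + inverse (real (Suc n)))\<^sup>2 - d\<^sup>2)"
  have e0: "e \<longlonglongrightarrow> 0"
  proof -
    have "e \<longlonglongrightarrow> (d + 0)\<^sup>2 - d\<^sup>2"
      unfolding e_def by (intro tendsto_intros LIMSEQ_inverse_real_of_nat)
    then show ?thesis by simp
  qed
  have Zle: "(norm (x - Z n))\<^sup>2 \<le> d\<^sup>2 + e n" for n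
  proof -
    have "(norm (x - Z n))\<^sup>2 \<le> (d + inverse (real (Suc n)))\<^sup>2"
      using Z(2)[of n] by (intro power_mono) auto
    then show ?thesis by (simp add: e_def)
  qed
  have "Cauchy Z"
  proof (rule metric_CauchyI)
    fix \<epsilon> :: real assume "\<epsilon> > 0"
    then have "\<epsilon>\<^sup>2 / 4 > 0" by simp
    from order_tendstoD(2)[OF e0 this] obtain M where M: "\<And>n. n \<ge> M \<Longrightarrow> e n < \<epsilon>\<^sup>2 / 4"
      unfolding eventually_sequentially by blast
    have "dist (Z i) (Z j) < \<epsilon>" if "i \<ge> M" "j \<ge> M" for i j
    proof -
      have "(norm (Z i - Z j))\<^sup>2 \<le> 2 * e i + 2 * e j"
        using par[of i j] Zle[of i] Zle[of j] by linarith
      also have "\<dots> < \<epsilon>\<^sup>2" using M[OF that(1)] M[OF that(2)] by linarith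
      finally show ?thesis
        using \<open>\<epsilon> > 0\<close> by (simp add: dist_norm power2_less_imp_less)
    qed
    then show "\<exists>M. \<forall>i\<ge>M. \<forall>j\<ge>M. dist (Z i) (Z j) < \<epsilon>" by blast
  qed
  then obtain y where y: "Z \<longlonglongrightarrow> y"
    using Cauchy_convergent_iff convergent_def by blast
  have "y \<in> S" using S(2) Z(1) y by (rule closed_sequentially)
  moreover have "norm (x - y) \<le> d"
  proof (rule LIMSEQ_le)
    show "(\<lambda>n. norm (x - Z n)) \<longlonglongrightarrow> norm (x - y)" by (intro tendsto_intros y)
    show "(\<lambda>n. d + inverse (real (Suc n))) \<longlonglongrightarrow> d"
      using tendsto_add[OF tendsto_const LIMSEQ_inverse_real_of_nat, of d] by simp
    show "\<exists>N. \<forall>n\<ge>N. norm (x - Z n) \<le> d + inverse (real (Suc n))"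
      using Z(2) less_imp_le by blast
  qed
  ultimately show ?thesis using d_le by (meson order_trans)
qed

lemma best_approximation_orthogonal:
  fixes S :: "'a::real_inner set"
  assumes "subspace S" "y \<in> S" "\<And>z. z \<in> S \<Longrightarrow> norm (x - y) \<le> norm (x - z)" "s \<in> S"
  shows "inner (x - y) s = 0"
proof (cases "s = 0")
  case False
  \<comment> \<open>The minimizer of the quadratic
    \<open>(norm (x - (y + c *\<^sub>R s)))\<^sup>2\<close> in \<open>c\<close>; the gain over
    \<open>c = 0\<close> is \<open>(inner (x - y) s)\<^sup>2 / inner s s\<close>.\<close>
  define c where "c = inner (x - y) s / inner s s"
  have "y + c *\<^sub>R s \<in> S" using assms by (simp add: subspace_add subspace_scale)
  then have "(norm (x - y))\<^sup>2 \<le> (norm (x - (y + c *\<^sub>R s)))\<^sup>2"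
    using assms(3) by (intro power_mono) auto
  also have "\<dots> = (norm (x - y))\<^sup>2 - 2 * c * inner (x - y) s + c\<^sup>2 * inner s s"
    unfolding power2_norm_eq_inner
    by (simp add: inner_diff_left inner_diff_right inner_add_left
        inner_add_right inner_commute algebra_simps power2_eq_square)
  also have "\<dots> = (norm (x - y))\<^sup>2 - (inner (x - y) s)\<^sup>2 / inner s s"
    using False by (simp add: c_def power2_eq_square)
  finally have "(inner (x - y) s)\<^sup>2 / inner s s \<le> 0" by simp
  moreover have "inner s s > 0" using False by simp
  ultimately have "(inner (x - y) s)\<^sup>2 \<le> 0" by (simp add: divide_le_0_iff)
  then show ?thesis by simp
qed simp

theorem real_proj_exists:
  fixes S :: "'a::{real_inner,complete_space} set"
  assumes S: "subspace S" "closed S"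
  shows "\<exists>P. real_proj P \<and> range P = S"
proof -
  obtain P where P: "\<And>x. P x \<in> S" "\<And>x z. z \<in> S \<Longrightarrow> norm (x - P x) \<le> norm (x - z)"
    using subspace_best_approximation_exists[OF S] by metis
  have orth: "inner (x - P x) s = 0" if "s \<in> S" for x s
    using best_approximation_orthogonal[OF S(1) P that] .
  \<comment> \<open>The residual condition characterizes \<open>P x\<close> and is linear in
    \<open>x\<close>, so additivity and homogeneity of \<open>P\<close> reduce to checking a
    candidate.\<close>
  have unique: "P x = y" if "y \<in> S" "\<And>s. s \<in> S \<Longrightarrow> inner (x - y) s = 0" for x y
  proof -
    have mem: "P x - y \<in> S" using S(1) P(1) that(1) by (simp add: subspace_diff)
    have "inner (P x - y) (P x - y) = inner (x - y) (P x - y) - inner (x - P x) (P x - y)"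
      by (simp add: inner_diff_left)
    also have "\<dots> = 0" using orth[OF mem] that(2)[OF mem] by simp
    finally show ?thesis by simp
  qed
  have fixed: "P x = x" if "x \<in> S" for x
    using that by (intro unique) auto
  have sym: "inner (P x) y = inner x (P y)" for x y
    using orth[OF P(1)[of y], of x] orth[OF P(1)[of x], of y]
    by (simp add: inner_diff_left inner_diff_right inner_commute)
  have le: "norm (P x) \<le> norm x" for x
  proof -
    have "(norm x)\<^sup>2 = (norm (P x))\<^sup>2 + (norm (x - P x))\<^sup>2"
      using orth[OF P(1), of x x]
      by (simp add: power2_norm_eq_inner inner_diff_left inner_diff_right inner_commute)
    then have "(norm (P x))\<^sup>2 \<le> (norm x)\<^sup>2" by simp
    then show ?thesis by simp
  qed
  have "bounded_linear P"
  proof (rule bounded_linear_intro[of _ 1])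
    fix x y show "P (x + y) = P x + P y"
    proof (rule unique)
      show "P x + P y \<in> S" using S(1) P(1) by (simp add: subspace_add)
      fix s assume "s \<in> S"
      then show "inner (x + y - (P x + P y)) s = 0"
        using orth[of s x] orth[of s y] by (simp add: inner_diff_left inner_add_left)
    qed
  next
    fix r x show "P (r *\<^sub>R x) = r *\<^sub>R P x"
    proof (rule unique)
      show "r *\<^sub>R P x \<in> S" using S(1) P(1) by (simp add: subspace_scale)
      fix s assume "s \<in> S"
      then show "inner (r *\<^sub>R x - r *\<^sub>R P x) s = 0"
        using orth[of s x] by (simp add: inner_diff_left)
    qed
  next
    fix x show "norm (P x) \<le> norm x * 1" using le by simp
  qed
  moreover have "range P = S" 
  proof (intro equalityI subsetI)
    fix x assume "x \<in> S"
    then show "x \<in> range P" using fixed[of x] by (metis rangeI)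
  qed (use P(1) in auto)
  ultimately have "real_proj P \<and> range P = S"
    unfolding real_proj_def using sym fixed P(1) by simp
  then show ?thesis by blast
qed

lemma proj_onto_closed_subspace:
  fixes S :: "'a::{real_inner,complete_space} set"
  assumes "subspace S" "closed S"
  shows "real_proj (proj_onto S)" and "range (proj_onto S) = S"
proof -
  obtain P where P: "real_proj P" "range P = S"
    using real_proj_exists[OF assms] by blast
  then show "real_proj (proj_onto S)" "range (proj_onto S) = S"
    using proj_onto_eqI[OF P] by simp_all
qed

lemma subspace_range_real_proj: "real_proj E \<Longrightarrow> subspace (range E)"
  by (meson bounded_linear.linear linear_subspace_image real_projD(1) subspace_UNIV)

section \<open>Consequences of an angle bound between two ranges\<close>

lemma real_proj_compose_norm_le:
  assumes E: "real_proj E" and F: "real_proj F" and "0 \<le> q"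
    and q: "\<And>x y. x \<in> range E \<Longrightarrow> y \<in> range F \<Longrightarrow> \<bar>inner x y\<bar> \<le> q * norm x * norm y"
  shows "norm (E (F x)) \<le> q * norm (F x)"
proof (cases "E (F x) = 0")
  case True
  then show ?thesis using \<open>0 \<le> q\<close> by simp
next
  case False
  have "(norm (E (F x)))\<^sup>2 = inner (E (F x)) (F x)"
    using real_proj_inner_self[OF E] by simp
  also have "\<dots> \<le> q * norm (E (F x)) * norm (F x)"
    using q[of "E (F x)" "F x"] by simp
  finally show ?thesis using False by (simp add: power2_eq_square mult.assoc mult.left_commute)
qed

text \<open>With \<open>u = v + w\<close>, \<open>p = E u\<close> and \<open>r = u - p\<close>, the
  vector \<open>E u + F u - u\<close> equals \<open>F p - (r - F r)\<close>, a part in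
  \<open>range F\<close> and a part orthogonal to it. Both \<open>p\<close> and \<open>r\<close> and
  these two parts are orthogonal pairs, so it suffices to bound \<open>F p\<close> by
  \<open>q * norm p\<close> and \<open>r - F r\<close> by \<open>q * norm r\<close>.\<close>

lemma real_proj_sum_diff_norm_le:
  assumes E: "real_proj E" and F: "real_proj F" and q0: "0 \<le> q" "q < 1"
    and q: "\<And>x y. x \<in> range E \<Longrightarrow> y \<in> range F \<Longrightarrow> \<bar>inner x y\<bar> \<le> q * norm x * norm y"
    and v: "v \<in> range E" and w: "w \<in> range F"
  shows "norm (E (v + w) + F (v + w) - (v + w)) \<le> q * norm (v + w)"
proof -
  define u p r where "u = v + w" and "p = E u" and "r = u - p"
  interpret E: bounded_linear E by (rule real_projD(1)[OF E])
  interpret F: bounded_linear F by (rule real_projD(1)[OF F])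
  have Ev: "E v = v" and Fw: "F w = w"
    using real_proj_fixes E F v w by blast+
  have q': "\<bar>inner x y\<bar> \<le> q * norm x * norm y" if "x \<in> range F" "y \<in> range E" for x y
    using q[OF that(2,1)] by (simp add: inner_commute mult.commute mult.left_commute)
  have Fp: "norm (F p) \<le> q * norm p"
    unfolding p_def using real_proj_compose_norm_le[OF F E q0(1) q'] .
  \<comment> \<open>The summand \<open>v\<close> is fixed by \<open>E\<close> and cancels, so
    \<open>r\<close> is what \<open>1 - E\<close> leaves of a vector of
    \<open>range F\<close>.\<close>
  have r: "r = w - E w" by (simp add: r_def p_def u_def E.add Ev)
  have Er: "E r = 0" using real_projD(2)[OF E] by (simp add: r E.diff)
  have u2: "(norm u)\<^sup>2 = (norm p)\<^sup>2 + (norm r)\<^sup>2"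
    unfolding r_def p_def using real_proj_pythagoras[OF E] .
  have Ew: "norm (E w) \<le> q * norm w"
    using real_proj_compose_norm_le[OF E F q0(1) q, of w] Fw by simp
  \<comment> \<open>Cauchy-Schwarz gives \<open>(norm r)\<^sup>2 \<le> norm (F r) * norm w\<close>,
    and the angle bound gives
    \<open>(norm w)\<^sup>2 * (1 - q\<^sup>2) \<le> (norm r)\<^sup>2\<close>. Eliminating
    \<open>norm w\<close> bounds \<open>F r\<close> from below, hence \<open>r - F r\<close> from
    above.\<close>
  have Fr: "(norm (r - F r))\<^sup>2 \<le> q\<^sup>2 * (norm r)\<^sup>2"
  proof (cases "r = 0")
    case True then show ?thesis by (simp add: F.zero)
  next
    case False
    have q2: "q\<^sup>2 < 1" using q0 by (simp add: power_less_one_iff)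
    have "inner r (E w) = 0" using Er real_projD(3)[OF E] by (metis inner_zero_left)
    then have "(norm r)\<^sup>2 = inner r w"
      unfolding power2_norm_eq_inner by (subst (2) r) (simp add: inner_diff_right)
    also have "\<dots> = inner (F r) w" using Fw real_projD(3)[OF F] by metis
    finally have "(norm r)\<^sup>2 \<le> norm (F r) * norm w"
      using norm_cauchy_schwarz[of "F r" w] by simp
    then have "((norm r)\<^sup>2)\<^sup>2 \<le> (norm (F r) * norm w)\<^sup>2"
      by (intro power_mono) auto
    then have 1: "((norm r)\<^sup>2)\<^sup>2 * (1 - q\<^sup>2) \<le> (norm (F r))\<^sup>2 * ((norm w)\<^sup>2 * (1 - q\<^sup>2))"
      using q2 mult_right_mono[of "((norm r)\<^sup>2)\<^sup>2" "(norm (F r) * norm w)\<^sup>2" "1 - q\<^sup>2"]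
      by (simp add: power_mult_distrib mult.assoc)
    have "(norm (E w))\<^sup>2 \<le> (q * norm w)\<^sup>2" using Ew by (intro power_mono) auto
    then have "(norm w)\<^sup>2 * (1 - q\<^sup>2) \<le> (norm r)\<^sup>2"
      using real_proj_pythagoras[OF E, of w] by (simp add: r power_mult_distrib algebra_simps)
    then have "(norm (F r))\<^sup>2 * ((norm w)\<^sup>2 * (1 - q\<^sup>2)) \<le> (norm (F r))\<^sup>2 * (norm r)\<^sup>2"
      by (intro mult_left_mono) auto
    with 1 have "(norm r)\<^sup>2 * ((norm r)\<^sup>2 * (1 - q\<^sup>2)) \<le> (norm r)\<^sup>2 * (norm (F r))\<^sup>2"
      by (simp add: power2_eq_square mult.assoc mult.commute mult.left_commute)
    then have "(norm r)\<^sup>2 * (1 - q\<^sup>2) \<le> (norm (F r))\<^sup>2"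
      by (rule mult_left_le_imp_le) (use False in simp)
    then show ?thesis
      using real_proj_pythagoras[OF F, of r] by (simp add: algebra_simps)
  qed
  have Tu: "E u + F u - u = F p - (r - F r)"
    by (simp add: r_def p_def F.diff)
  have "inner (F p) (r - F r) = 0"
    using real_projD(2,3)[OF F] by (metis F.diff cancel_comm_monoid_add_class.diff_cancel inner_zero_right)
  then have "(norm (E u + F u - u))\<^sup>2 = (norm (F p))\<^sup>2 + (norm (r - F r))\<^sup>2"
    unfolding Tu by (simp add: power2_norm_eq_inner inner_diff_left inner_diff_right inner_commute)
  also have "\<dots> \<le> (q * norm p)\<^sup>2 + q\<^sup>2 * (norm r)\<^sup>2"
    by (intro add_mono power_mono Fp Fr) simp
  also have "\<dots> = (q * norm u)\<^sup>2" using u2 by (simp add: power_mult_distrib algebra_simps)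
  finally show ?thesis
    using q0 unfolding u_def by (meson mult_nonneg_nonneg norm_ge_zero power2_le_imp_le)
qed

lemma span_Un_range_real_proj:
  assumes "real_proj E" "real_proj F"
  shows "span (range E \<union> range F) = {v + w |v w. v \<in> range E \<and> w \<in> range F}"
  using span_Un[of "range E" "range F"] subspace_range_real_proj[OF assms(1)]
    subspace_range_real_proj[OF assms(2)] by (simp add: span_eq_iff[THEN iffD2])

text \<open>The estimate on sums \<open>v + w\<close> is a closed condition, so it extends to the
  range of the join \<open>P\<close>. For arbitrary \<open>x\<close> it is applied to
  \<open>P x\<close>, on which \<open>E\<close> and \<open>F\<close> take the same values as on
  \<open>x\<close>.\<close>

lemma proj_join_norm_le:
  fixes E F :: "'a::{real_inner,complete_space} \<Rightarrow> 'a"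
  assumes E: "real_proj E" and F: "real_proj F" and q0: "0 \<le> q" "q < 1"
    and q: "\<And>x y. x \<in> range E \<Longrightarrow> y \<in> range F \<Longrightarrow> \<bar>inner x y\<bar> \<le> q * norm x * norm y"
  shows "norm (E x + F x - proj_join E F x) \<le> q * norm x"
proof -
  define S where "S = span (range E \<union> range F)"
  define P where "P = proj_join E F"
  have sub: "subspace (closure S)" unfolding S_def by (simp add: subspace_closure)
  have P: "real_proj P" "range P = closure S"
    unfolding P_def proj_join_def S_def[symmetric]
    using proj_onto_closed_subspace[OF sub] by simp_all
  interpret E: bounded_linear E by (rule real_projD(1)[OF E])
  interpret F: bounded_linear F by (rule real_projD(1)[OF F])
  have "closed {u. norm (E u + F u - u) \<le> q * norm u}"
    by (intro closed_Collect_le continuous_intros E.continuous_on F.continuous_on)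
  moreover have "S \<subseteq> {u. norm (E u + F u - u) \<le> q * norm u}"
    unfolding S_def span_Un_range_real_proj[OF E F]
    using real_proj_sum_diff_norm_le[OF E F q0 q] by blast
  ultimately have "closure S \<subseteq> {u. norm (E u + F u - u) \<le> q * norm u}"
    by (rule closure_minimal[rotated])
  then have 1: "norm (E (P x) + F (P x) - P x) \<le> q * norm (P x)"
    using P(2) by blast
  \<comment> \<open>\<open>P\<close> fixes the range of \<open>G\<close>, so
    \<open>P (G y) = G y\<close>; passing to adjoints reverses the order.\<close>
  have absorb: "G (P x) = G x" if "real_proj G" "range G \<subseteq> S" for G
  proof -
    have "P (G y) = G y" for y
      using that(2) P real_proj_fixes closure_subset by (metis rangeI subsetD)
    then have "inner (G (P x)) y = inner (G x) y" for y
      using real_projD(3)[OF that(1)] real_projD(3)[OF P(1)] by metis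
    then show ?thesis using vector_eq_rdot[of "G (P x)" "G x"] by simp
  qed
  have "range E \<subseteq> S" "range F \<subseteq> S" unfolding S_def by (auto intro: span_base)
  then have "E (P x) = E x" "F (P x) = F x" using absorb E F by auto
  with 1 have "norm (E x + F x - P x) \<le> q * norm (P x)" by simp
  also have "\<dots> \<le> q * norm x" using q0 real_proj_norm_le[OF P(1)] by (intro mult_left_mono) auto
  finally show ?thesis by (simp add: P_def)
qed

text \<open>A common vector, paired with itself, satisfies
  \<open>(norm x)\<^sup>2 \<le> q * (norm x)\<^sup>2\<close> and so vanishes.\<close>

lemma proj_meet_eq_zero:
  assumes E: "real_proj E" and F: "real_proj F" and q1: "q < 1"
    and q: "\<And>x y. x \<in> range E \<Longrightarrow> y \<in> range F \<Longrightarrow> \<bar>inner x y\<bar> \<le> q * norm x * norm y"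
  shows "proj_meet E F = (\<lambda>_. 0)"
  unfolding proj_meet_def
proof (rule proj_onto_eqI)
  show "real_proj (\<lambda>_. 0)" by (simp add: real_proj_def bounded_linear_zero)
  have "x = 0" if "x \<in> range E" "x \<in> range F" for x
  proof (rule ccontr)
    assume "x \<noteq> 0"
    moreover have "(norm x)\<^sup>2 \<le> q * (norm x)\<^sup>2"
      using q[OF that] by (simp add: power2_norm_eq_inner[symmetric] power2_eq_square mult.assoc)
    ultimately show False using q1 by simp
  qed
  moreover have "0 \<in> range E" "0 \<in> range F"
    using subspace_range_real_proj E F subspace_0 by blast+
  ultimately show "range (\<lambda>_. 0) = range E \<inter> range F" by auto
qed

section \<open>Bounded functions on the slit plane\<close>

lemma Re_complex_of_real_mult: "Re (of_real c * z) = c * Re z"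
  by simp

lemma Im_complex_of_real_mult: "Im (of_real c * z) = c * Im z"
  by simp

text \<open>The map \<open>w \<mapsto> 2 w / (1 + w\<^sup>2)\<close> sends the unit disc onto the plane slit along the real \<open>t\<close> with
  \<open>\<bar>t\<bar> \<ge> 1\<close>, and \<open>(1 - w\<^sup>2) / (1 + w\<^sup>2)\<close> is \<open>sqrt (1 - z\<^sup>2)\<close> in this coordinate: its real part is the
  harmonic function that vanishes on the slits and grows like \<open>\<bar>Im z\<bar>\<close>.\<close>

lemma slit_plane_exponent_bound:
  fixes w :: complex
  assumes "cmod w < 1"
  shows "1 + w\<^sup>2 \<noteq> 0"
    and "Im (2 * w / (1 + w\<^sup>2)) = 2 * Im w * (1 - (cmod w)\<^sup>2) / (cmod (1 + w\<^sup>2))\<^sup>2"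
    and "Re ((1 - w\<^sup>2) / (1 + w\<^sup>2)) - \<bar>Im (2 * w / (1 + w\<^sup>2))\<bar> \<le> 1 - (cmod w)\<^sup>2"
proof -
  define a b \<rho> where "a = Re w" and "b = Im w" and "\<rho> = (cmod w)\<^sup>2"
  have \<rho>: "\<rho> = a\<^sup>2 + b\<^sup>2" by (simp add: \<rho>_def cmod_power2 a_def b_def)
  have w: "w = Complex a b" by (simp add: a_def b_def)
  have \<rho>1: "\<rho> < 1"
    using assms by (simp add: \<rho>_def power2_eq_square) (metis mult_strict_mono norm_ge_zero mult_1 zero_less_one)
  show nz: "1 + w\<^sup>2 \<noteq> 0"
  proof
    assume "1 + w\<^sup>2 = 0"
    then have "w\<^sup>2 = -1" by (simp add: add_eq_0_iff)
    then have "(cmod w)\<^sup>2 = 1" by (metis norm_minus_cancel norm_one norm_power)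
    with \<rho>1 show False by (simp add: \<rho>_def)
  qed
  define N where "N = (cmod (1 + w\<^sup>2))\<^sup>2"
  \<comment> \<open>The factorization \<open>1 + w\<^sup>2 = (1 + \<i> * w) * (1 - \<i> * w)\<close>
    in squared moduli.\<close>
  have N: "N = (1 + \<rho> - 2 * b) * (1 + \<rho> + 2 * b)"
    unfolding N_def cmod_power2 \<rho> w
    by (simp add: power2_eq_square complex_eq_iff) algebra
  have Npos: "N > 0" using nz by (simp add: N_def)
  have N': "N = (Re (1 + w\<^sup>2))\<^sup>2 + (Im (1 + w\<^sup>2))\<^sup>2"
    by (simp add: N_def cmod_power2)
  show im: "Im (2 * w / (1 + w\<^sup>2)) = 2 * Im w * (1 - (cmod w)\<^sup>2) / (cmod (1 + w\<^sup>2))\<^sup>2"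
  proof -
    have "Im (2 * w) * Re (1 + w\<^sup>2) - Re (2 * w) * Im (1 + w\<^sup>2) = 2 * Im w * (1 - \<rho>)"
      unfolding \<rho> w by (simp add: power2_eq_square algebra_simps)
    then show ?thesis
      unfolding \<rho>_def[symmetric] by (simp only: Im_divide N'[symmetric] N_def[symmetric])
  qed
  have re: "Re ((1 - w\<^sup>2) / (1 + w\<^sup>2)) = (1 - \<rho>) * (1 + \<rho>) / N"
  proof -
    have "Re (1 - w\<^sup>2) * Re (1 + w\<^sup>2) + Im (1 - w\<^sup>2) * Im (1 + w\<^sup>2) = (1 - \<rho>) * (1 + \<rho>)"
      unfolding \<rho> w by (simp add: power2_eq_square algebra_simps)
    then show ?thesis
      by (simp only: Re_divide N'[symmetric])
  qed
  have "\<bar>Im (2 * w / (1 + w\<^sup>2))\<bar> = 2 * \<bar>b\<bar> * (1 - \<rho>) / N"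
    using \<rho>1 Npos unfolding im \<rho>_def[symmetric] N_def[symmetric] b_def
    by (simp add: abs_mult)
  then have eq: "Re ((1 - w\<^sup>2) / (1 + w\<^sup>2)) - \<bar>Im (2 * w / (1 + w\<^sup>2))\<bar>
      = (1 - \<rho>) * ((1 + \<rho> - 2 * \<bar>b\<bar>) / N)"
    unfolding re by (simp add: diff_divide_distrib algebra_simps)
  \<comment> \<open>The numerator \<open>1 + \<rho> - 2 * \<bar>b\<bar>\<close> is itself a factor
    of \<open>N\<close>, and the other factor is at least 1, so the quotient in \<open>eq\<close> is
    at most 1.\<close>
  have N2: "N = (1 + \<rho> - 2 * \<bar>b\<bar>) * (1 + \<rho> + 2 * \<bar>b\<bar>)"
    unfolding N by (cases "b \<ge> 0") (simp_all add: algebra_simps)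
  have "1 + \<rho> - 2 * \<bar>b\<bar> = a\<^sup>2 + (1 - \<bar>b\<bar>)\<^sup>2"
    unfolding \<rho> by (simp add: power2_eq_square algebra_simps)
  then have pos: "1 + \<rho> - 2 * \<bar>b\<bar> \<ge> 0" by simp
  have "\<rho> \<ge> 0" by (simp add: \<rho>_def)
  then have "1 + \<rho> - 2 * \<bar>b\<bar> \<le> N"
    unfolding N2 using mult_left_mono[OF _ pos, of 1 "1 + \<rho> + 2 * \<bar>b\<bar>"] by simp
  then have "(1 + \<rho> - 2 * \<bar>b\<bar>) / N \<le> 1" using Npos by simp
  then show "Re ((1 - w\<^sup>2) / (1 + w\<^sup>2)) - \<bar>Im (2 * w / (1 + w\<^sup>2))\<bar> \<le> 1 - (cmod w)\<^sup>2"
    unfolding eq \<rho>_def[symmetric] using \<rho>1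
    by (metis diff_ge_0_iff_ge less_imp_le mult_left_mono mult.right_neutral)
qed

text \<open>After reflection the function is pulled back to the unit disc and multiplied by an
  exponential that compensates its decay; the maximum principle then compares the centre with the
  circle of radius \<open>r\<close>. Stopping at \<open>r < 1\<close> keeps the image bounded and
  off the slits, at the price of \<open>r\<^sup>2\<close> in the exponent.\<close>

lemma reflected_strip_bound:
  fixes F :: "complex \<Rightarrow> complex"
  assumes d: "\<delta> > 0" and m: "m > 0" and r: "0 < r" "r < 1" and R: "2 * \<delta> / (1 - r\<^sup>2) < R"
    and C: "0 \<le> C"
    and hol: "F holomorphic_on {z. \<bar>Re z\<bar> < R \<and> 0 < Im z \<and> Im z < R}"
    and cont: "continuous_on {z. \<bar>Re z\<bar> < R \<and> 0 \<le> Im z \<and> Im z < R} F"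
    and real: "\<And>t. \<bar>t\<bar> < \<delta> \<Longrightarrow> F (of_real t) \<in> \<real>"
    and bound: "\<And>z. \<bar>Re z\<bar> < R \<Longrightarrow> 0 \<le> Im z \<Longrightarrow> Im z < R \<Longrightarrow> cmod (F z) \<le> C * exp (- m * Im z)"
  shows "cmod (F 0) \<le> C * exp (- m * \<delta> * r\<^sup>2)"
proof -
  \<comment> \<open>The square without the real points with
    \<open>\<bar>t\<bar> \<ge> \<delta>\<close>: reflection is possible only across the interval on
    which \<open>F\<close> is real.\<close>
  define S where "S = {z. \<bar>Re z\<bar> < R \<and> \<bar>Im z\<bar> < R \<and> (Im z \<noteq> 0 \<or> \<bar>Re z\<bar> < \<delta>)}"
  define G where "G = (\<lambda>z. if 0 \<le> Im z then F z else cnj (F (cnj z)))"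
  have "open S"
    unfolding S_def
    by (intro open_Collect_conj open_Collect_disj open_Collect_less open_Collect_neq continuous_intros)
  have G: "G holomorphic_on S"
    unfolding G_def
  proof (rule Schwarz_reflection[OF \<open>open S\<close>])
    show "cnj ` S \<subseteq> S" by (auto simp: S_def)
    show "F holomorphic_on S \<inter> {z. 0 < Im z}"
      by (rule holomorphic_on_subset[OF hol]) (auto simp: S_def)
    show "continuous_on (S \<inter> {z. 0 \<le> Im z}) F"
      by (rule continuous_on_subset[OF cont]) (auto simp: S_def)
    fix z assume "z \<in> S" "z \<in> \<real>"
    then show "F z \<in> \<real>"
      using real by (auto simp: S_def Reals_def)
  qed
  have Gb: "cmod (G z) \<le> C * exp (- m * \<bar>Im z\<bar>)" if "z \<in> S" for z
  proof (cases "0 \<le> Im z")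
    case True
    then show ?thesis using that bound[of z] by (simp add: G_def S_def)
  next
    case False
    then show ?thesis using that bound[of "cnj z"] by (simp add: G_def S_def)
  qed
  define \<phi> where "\<phi> = (\<lambda>w::complex. of_real \<delta> * (2 * w / (1 + w\<^sup>2)))"
  \<comment> \<open>The exponential has modulus \<open>exp (m * \<delta>)\<close> at the centre. On
    the circle of radius \<open>r\<close> the decay of \<open>G\<close> cancels it up to
    \<open>exp (m * \<delta> * (1 - r\<^sup>2))\<close>, by
    \<open>slit_plane_exponent_bound\<close>.\<close>
  define H where "H = (\<lambda>w. G (\<phi> w) * exp (of_real (m * \<delta>) * ((1 - w\<^sup>2) / (1 + w\<^sup>2))))"
  have lt1: "cmod w < 1" if "w \<in> cball 0 r" for w
    using that r by simp
  \<comment> \<open>The bound \<open>cmod (1 + w\<^sup>2) \<ge> 1 - r\<^sup>2\<close> makes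
    \<open>cmod (\<phi> w)\<close> at most \<open>2 * \<delta> / (1 - r\<^sup>2)\<close>, which is
    why \<open>R\<close> must exceed this number. A real value of \<open>\<phi>\<close> comes from a
    real \<open>w\<close>, and then \<open>2 * \<bar>a\<bar> < 1 + a\<^sup>2\<close> keeps it off
    the slits.\<close>
  have \<phi>S: "\<phi> w \<in> S" if w: "w \<in> cball 0 r" for w
  proof -
    have w1: "cmod w < 1" using lt1[OF w] .
    note nz = slit_plane_exponent_bound[OF w1]
    have wr: "cmod w \<le> r" using w by simp
    have r2: "r\<^sup>2 < 1" using r by (simp add: power_less_one_iff)
    have "1 - r\<^sup>2 \<le> 1 - (cmod w)\<^sup>2" using wr by (simp add: power_mono)
    also have "\<dots> \<le> cmod (1 + w\<^sup>2)"
      using norm_diff_ineq[of 1 "w\<^sup>2"] by (simp add: norm_power)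
    finally have low: "1 - r\<^sup>2 \<le> cmod (1 + w\<^sup>2)" .
    have "cmod (\<phi> w) = \<delta> * (2 * cmod w / cmod (1 + w\<^sup>2))"
      using d by (simp add: \<phi>_def norm_mult norm_divide)
    also have "\<dots> \<le> \<delta> * (2 * 1 / (1 - r\<^sup>2))"
      using d w1 low r2 by (intro mult_left_mono frac_le) auto
    also have "\<dots> < R" using R by (simp add: mult.commute)
    finally have "cmod (\<phi> w) < R" .
    then have 1: "\<bar>Re (\<phi> w)\<bar> < R" "\<bar>Im (\<phi> w)\<bar> < R"
      using abs_Re_le_cmod[of "\<phi> w"] abs_Im_le_cmod[of "\<phi> w"] by linarith+
    have "\<bar>Re (\<phi> w)\<bar> < \<delta>" if im0: "Im (\<phi> w) = 0"
    proof -
      have "Im (\<phi> w) = \<delta> * Im (2 * w / (1 + w\<^sup>2))"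
        unfolding \<phi>_def by (simp only: Im_complex_of_real_mult)
      with im0 d have "Im (2 * w / (1 + w\<^sup>2)) = 0" by simp
      moreover have "(cmod w)\<^sup>2 < 1" using w1 by (simp add: power_less_one_iff)
      ultimately have "Im w = 0" unfolding nz(2) using nz(1) by simp
      then obtain a where a: "w = of_real a"
        by (metis complex_is_Real_iff Reals_cases)
      have a1: "\<bar>a\<bar> < 1" using w1 a by simp
      have "\<phi> w = of_real (\<delta> * (2 * a / (1 + a\<^sup>2)))"
        by (simp add: \<phi>_def a)
      then have "Re (\<phi> w) = \<delta> * (2 * a / (1 + a\<^sup>2))" by simp
      moreover have "\<bar>2 * a / (1 + a\<^sup>2)\<bar> < 1"
      proof -
        have "0 < (1 - \<bar>a\<bar>)\<^sup>2" using a1 by simp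
        then have "2 * \<bar>a\<bar> < 1 + a\<^sup>2" by (simp add: power2_eq_square algebra_simps)
        then show ?thesis by (simp add: abs_mult add_pos_nonneg)
      qed
      ultimately show ?thesis
        using mult_strict_left_mono[of "\<bar>2 * a / (1 + a\<^sup>2)\<bar>" 1 \<delta>] d by (simp add: abs_mult)
    qed
    with 1 show ?thesis by (auto simp: S_def)
  qed
  have \<phi>hol: "\<phi> holomorphic_on cball 0 r"
    unfolding \<phi>_def using slit_plane_exponent_bound(1)[OF lt1]
    by (intro holomorphic_intros) auto
  have Hhol: "H holomorphic_on cball 0 r"
    unfolding H_def using slit_plane_exponent_bound(1)[OF lt1] \<phi>S
    by (intro holomorphic_on_mult holomorphic_on_compose_gen[OF \<phi>hol G, unfolded o_def]
        holomorphic_intros) auto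
  have "cmod (H 0) \<le> C * exp (m * \<delta> * (1 - r\<^sup>2))"
  proof (rule maximum_modulus_frontier[where f = H and \<xi> = 0 and S = "cball 0 r"])
    show "H holomorphic_on interior (cball 0 r)"
      by (rule holomorphic_on_subset[OF Hhol]) auto
    show "continuous_on (closure (cball 0 r)) H"
      using holomorphic_on_imp_continuous_on[OF Hhol] by simp
    show "bounded (cball (0::complex) r)" "0 \<in> cball (0::complex) r" using r by auto
    fix w :: complex assume "w \<in> frontier (cball 0 r)"
    then have w: "cmod w = r" by simp
    then have wb: "w \<in> cball 0 r" by simp
    have eq: "Im (\<phi> w) = \<delta> * Im (2 * w / (1 + w\<^sup>2))"
      unfolding \<phi>_def by (simp only: Im_complex_of_real_mult)
    have "cmod (H w) = cmod (G (\<phi> w)) * exp (m * \<delta> * Re ((1 - w\<^sup>2) / (1 + w\<^sup>2)))"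
      unfolding H_def norm_mult norm_exp_eq_Re by (simp only: Re_complex_of_real_mult)
    also have "\<dots> \<le> C * exp (- m * \<bar>Im (\<phi> w)\<bar>) * exp (m * \<delta> * Re ((1 - w\<^sup>2) / (1 + w\<^sup>2)))"
      by (intro mult_right_mono Gb \<phi>S wb) simp
    also have "\<dots> = C * exp (m * \<delta> * (Re ((1 - w\<^sup>2) / (1 + w\<^sup>2)) - \<bar>Im (2 * w / (1 + w\<^sup>2))\<bar>))"
      unfolding eq abs_mult using d by (simp add: exp_add[symmetric] algebra_simps)
    also have "\<dots> \<le> C * exp (m * \<delta> * (1 - r\<^sup>2))"
      using slit_plane_exponent_bound(3)[OF lt1[OF wb]] w m d C
      by (intro mult_left_mono) auto
    finally show "cmod (H w) \<le> C * exp (m * \<delta> * (1 - r\<^sup>2))" .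
  qed
  moreover have "cmod (H 0) = cmod (F 0) * exp (m * \<delta>)"
    by (simp add: H_def \<phi>_def G_def norm_mult)
  ultimately have "cmod (F 0) * exp (m * \<delta>) \<le> C * exp (m * \<delta> * (1 - r\<^sup>2))" by simp
  then have "cmod (F 0) * exp (m * \<delta>) * exp (- m * \<delta>) \<le> C * exp (m * \<delta> * (1 - r\<^sup>2)) * exp (- m * \<delta>)"
    by (rule mult_right_mono) simp
  then show ?thesis
    by (simp add: mult.assoc exp_add[symmetric] algebra_simps)
qed

section \<open>Unitary groups and mollified orbits\<close>

locale unitary_flow =
  fixes J :: "'a::{real_inner,banach} \<Rightarrow> 'a" and V :: "real \<Rightarrow> 'a \<Rightarrow> 'a"
  assumes J: "complex_structure J" and V: "unitary_group J V"
begin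

lemma bounded_linear_J: "bounded_linear J"
  and J_J [simp]: "J (J x) = - x"
  and inner_J_J [simp]: "inner (J x) (J y) = inner x y"
  using J by (auto simp: complex_structure_def)

sublocale J: bounded_linear J
  by (rule bounded_linear_J)

lemma norm_J [simp]: "norm (J x) = norm x"
  by (simp add: norm_eq_sqrt_inner)

lemma inner_J_self [simp]: "inner x (J x) = 0"
  using inner_J_J[of x "J x"] by (simp add: inner_commute)

lemma bounded_linear_V: "bounded_linear (V t)"
  and norm_V [simp]: "norm (V t x) = norm x"
  and V_J: "V t (J x) = J (V t x)"
  and V_0 [simp]: "V 0 x = x"
  and V_add: "V (s + t) x = V s (V t x)"
  and continuous_V: "continuous_on UNIV (\<lambda>t. V t x)"
  using V by (auto simp: unitary_group_def)

sublocale V: bounded_linear "V t" for t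
  by (rule bounded_linear_V)

lemma continuous_on_V [continuous_intros]:
  "continuous_on S f \<Longrightarrow> continuous_on S (\<lambda>x. V (f x) y)"
  using continuous_on_compose2[OF continuous_V] by blast

section \<open>Complex scalars, the complex inner product and mollification\<close>

definition cscale :: "complex \<Rightarrow> 'a \<Rightarrow> 'a" where
  "cscale c v = Re c *\<^sub>R v + Im c *\<^sub>R J v"

lemma norm_cscale: "norm (cscale c v) = cmod c * norm v"
proof -
  have "(norm (cscale c v))\<^sup>2 = (cmod c)\<^sup>2 * (norm v)\<^sup>2"
    unfolding cscale_def cmod_power2 power2_norm_eq_inner
    by (simp add: inner_add_left inner_add_right inner_commute[of "J v" v] power2_eq_square
        algebra_simps)
  then show ?thesis
    by (metis norm_ge_zero power2_eq_imp_eq power_mult_distrib mult_nonneg_nonneg)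
qed

lemma bounded_bilinear_cscale: "bounded_bilinear cscale"
proof
  show "\<exists>K. \<forall>c v. norm (cscale c v) \<le> cmod c * norm v * K"
    by (rule exI[of _ 1]) (simp add: norm_cscale)
qed (simp_all add: cscale_def J.add J.scaleR algebra_simps)

sublocale cscale: bounded_bilinear cscale
  by (rule bounded_bilinear_cscale)

lemmas continuous_on_cscale [continuous_intros] = cscale.continuous_on

lemma V_cscale: "V t (cscale c v) = cscale c (V t v)"
  by (simp add: cscale_def V.add V.scaleR V_J)

lemma cscale_i: "cscale (\<i> * c) v = J (cscale c v)"
  by (simp add: cscale_def J.add J.scaleR)

lemma cscale_of_real: "cscale (of_real c) v = c *\<^sub>R v"
  by (simp add: cscale_def)

text \<open>The complex inner product with real part \<open>inner\<close>, conjugate-linear in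
  \<open>x\<close> and linear in \<open>v\<close>. It is real exactly when
  \<open>inner x (J v) = 0\<close>, the form in which the symplectic condition enters.\<close>

definition cpair :: "'a \<Rightarrow> 'a \<Rightarrow> complex" where
  "cpair x v = Complex (inner x v) (- inner x (J v))"

lemma cpair_cscale: "cpair x (cscale c v) = c * cpair x v"
  by (simp add: cpair_def cscale_def complex_eq_iff J.add J.scaleR inner_add_right algebra_simps)

text \<open>Multiplying \<open>v\<close> by the conjugate of the pairing makes the pairing real and
  nonnegative, so the real Cauchy-Schwarz inequality applies.\<close>

lemma cmod_cpair_le: "cmod (cpair x v) \<le> norm x * norm v"
proof (cases "cpair x v = 0")
  case False
  have "cpair x (cscale (cnj (cpair x v)) v) = of_real ((cmod (cpair x v))\<^sup>2)"
    unfolding cpair_cscale by (metis complex_norm_square mult.commute)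
  then have "(cmod (cpair x v))\<^sup>2 = inner x (cscale (cnj (cpair x v)) v)"
    by (metis Re_complex_of_real cpair_def complex.sel(1))
  also have "\<dots> \<le> norm x * norm (cscale (cnj (cpair x v)) v)"
    by (rule norm_cauchy_schwarz)
  finally show ?thesis
    using False by (simp add: norm_cscale power2_eq_square mult.left_commute)
qed simp

lemma bounded_linear_cpair: "bounded_linear (cpair x)"
  by (rule bounded_linear_intro[of _ "norm x"])
    (use cmod_cpair_le[of x] in \<open>simp_all add: cpair_def complex_eq_iff J.add J.scaleR
      inner_add_right mult.commute\<close>)

sublocale cpair: bounded_linear "cpair x" for x
  by (rule bounded_linear_cpair)

text \<open>Convolution of the orbit of \<open>y\<close> with \<open>k\<close>, cut off to a compact
  window. The complex variable \<open>z\<close> enters only through the kernel, so an entire kernel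
  yields an orbit that is entire in \<open>z\<close>.\<close>

definition mollify :: "real \<Rightarrow> (complex \<Rightarrow> complex) \<Rightarrow> 'a \<Rightarrow> complex \<Rightarrow> 'a" where
  "mollify N k y z = integral {-N..N} (\<lambda>u. cscale (k (of_real u - z)) (V u y))"

lemma integrable_mollify:
  fixes k :: "complex \<Rightarrow> complex"
  assumes "continuous_on UNIV k"
  shows "(\<lambda>u. cscale (k (of_real u - z)) (V u y)) integrable_on {a..b}"
  by (intro integrable_continuous_interval continuous_intros continuous_on_compose2[OF assms]) auto

text \<open>Differentiating the kernel in \<open>s\<close> produces the factor
  \<open>- \<i>\<close>, which acts on vectors as \<open>- J\<close>. The shape
  \<open>J (D s)\<close> is the one that \<open>energy_estimate\<close> expects.\<close>

lemma mollify_imaginary_derivative: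
  assumes k: "\<And>w. (k has_field_derivative k' w) (at w)" and k': "continuous_on UNIV k'"
  shows "((\<lambda>s. mollify N k y (z + \<i> * of_real s)) has_vector_derivative
    J (- mollify N k' y (z + \<i> * of_real s))) (at s)"
proof -
  have k0: "continuous_on UNIV k"
    using k DERIV_isCont by (blast intro: continuous_at_imp_continuous_on)
  have "((\<lambda>s. integral (cbox (-N) N) (\<lambda>u. cscale (k (of_real u - (z + \<i> * of_real s))) (V u y)))
    has_vector_derivative integral (cbox (-N) N)
      (\<lambda>u. cscale (- \<i> * k' (of_real u - (z + \<i> * of_real s))) (V u y))) (at s within UNIV)"
  proof (rule leibniz_rule_vector_derivative)
    fix s u :: real
    have "((\<lambda>s. of_real u - (z + \<i> * of_real s)) has_vector_derivative - \<i>) (at s)"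
      by (auto intro!: derivative_eq_intros)
    from field_vector_diff_chain_at[OF this k]
    have "((\<lambda>s. k (of_real u - (z + \<i> * of_real s))) has_vector_derivative
      - \<i> * k' (of_real u - (z + \<i> * of_real s))) (at s)"
      by (simp add: o_def)
    then show "((\<lambda>s. cscale (k (of_real u - (z + \<i> * of_real s))) (V u y)) has_vector_derivative
        cscale (- \<i> * k' (of_real u - (z + \<i> * of_real s))) (V u y)) (at s within UNIV)"
      by (rule bounded_linear.has_vector_derivative[OF cscale.bounded_linear_left])
  next
    show "continuous_on (UNIV \<times> cbox (-N) N)
        (\<lambda>(s, u). cscale (- \<i> * k' (of_real u - (z + \<i> * of_real s))) (V u y))"
      unfolding split_beta
      by (intro continuous_intros continuous_on_compose2[OF k']) auto
  qed (use integrable_mollify[OF k0] in auto)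
  moreover have "integral {-N..N} (\<lambda>u. cscale (- \<i> * k' (of_real u - w)) (V u y))
      = J (- mollify N k' y w)" for w
  proof -
    have bl: "bounded_linear (\<lambda>x. J (- x))"
      by (intro bounded_linear_compose[OF bounded_linear_J] bounded_linear_minus bounded_linear_ident)
    have "(\<lambda>u. cscale (- \<i> * k' (of_real u - w)) (V u y))
        = (\<lambda>x. J (- x)) \<circ> (\<lambda>u. cscale (k' (of_real u - w)) (V u y))"
      by (simp add: fun_eq_iff cscale_i cscale.minus_left J.neg)
    then show ?thesis
      unfolding mollify_def using integral_linear[OF integrable_mollify[OF k'] bl] by simp
  qed
  ultimately show ?thesis by (simp add: mollify_def)
qed

lemma orbit_derivative:
  assumes "((\<lambda>t. V t y) has_vector_derivative a) (at 0)"
  shows "((\<lambda>t. V t y) has_vector_derivative V u a) (at u)"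
proof -
  have "((\<lambda>t. t - u) has_vector_derivative 1) (at u)"
    by (auto intro!: derivative_eq_intros)
  moreover have "((\<lambda>t. V t y) has_vector_derivative a) (at (u - u))"
    using assms by simp
  ultimately have "((\<lambda>t. V (t - u) y) has_vector_derivative a) (at u)"
    using vector_diff_chain_at[of "\<lambda>t. t - u" 1 u "\<lambda>t. V t y" a] by (simp add: o_def)
  then have "((\<lambda>t. V u (V (t - u) y)) has_vector_derivative V u a) (at u)"
    by (rule bounded_linear.has_vector_derivative[OF bounded_linear_V])
  then show ?thesis by (simp add: V_add[symmetric])
qed

text \<open>\<open>V t\<close> only shifts the orbit under the integral, so the generator passes
  inside and acts on \<open>y\<close>.\<close>

lemma mollify_orbit_derivative:
  assumes k: "continuous_on UNIV k" and a: "((\<lambda>t. V t y) has_vector_derivative a) (at 0)"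
  shows "((\<lambda>t. V t (mollify N k y z)) has_vector_derivative mollify N k a z) (at 0)"
proof -
  have eq: "V t (mollify N k y z) = integral (cbox (-N) N) (\<lambda>u. cscale (k (of_real u - z)) (V (t + u) y))"
    for t
    unfolding mollify_def
    using integral_linear[OF integrable_mollify[OF k, of z y "-N" N] bounded_linear_V[of t]]
    by (simp add: o_def V_cscale V_add)
  have "((\<lambda>t. integral (cbox (-N) N) (\<lambda>u. cscale (k (of_real u - z)) (V (t + u) y)))
    has_vector_derivative integral (cbox (-N) N) (\<lambda>u. cscale (k (of_real u - z)) (V (0 + u) a)))
    (at 0 within UNIV)"
  proof (rule leibniz_rule_vector_derivative)
    fix t u :: real
    have "((\<lambda>t. t + u) has_vector_derivative 1) (at t)"
      by (auto intro!: derivative_eq_intros)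
    from vector_diff_chain_at[OF this orbit_derivative[OF a]]
    have "((\<lambda>t. V (t + u) y) has_vector_derivative V (t + u) a) (at t)"
      by (simp add: o_def)
    then show "((\<lambda>t. cscale (k (of_real u - z)) (V (t + u) y)) has_vector_derivative
        cscale (k (of_real u - z)) (V (t + u) a)) (at t within UNIV)"
      by (rule bounded_linear.has_vector_derivative[OF cscale.bounded_linear_right])
  next
    fix t show "(\<lambda>u. cscale (k (of_real u - z)) (V (t + u) y)) integrable_on cbox (-N) N"
      by (intro integrable_continuous continuous_intros continuous_on_compose2[OF k]) auto
  next
    show "continuous_on (UNIV \<times> cbox (-N) N) (\<lambda>(t, u). cscale (k (of_real u - z)) (V (t + u) a))"
      unfolding split_beta
      by (intro continuous_intros continuous_on_compose2[OF k]) auto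
  qed auto
  then have "((\<lambda>t. V t (mollify N k y z)) has_vector_derivative
      integral (cbox (-N) N) (\<lambda>u. cscale (k (of_real u - z)) (V (0 + u) a))) (at 0)"
    unfolding eq .
  then show ?thesis by (simp add: mollify_def)
qed

text \<open>The derivative moves from the orbit to the kernel. Thus the generator applied to the
  mollified orbit is its derivative in the real direction, up to two boundary terms caused by the
  cutoff.\<close>

lemma mollify_by_parts:
  assumes k: "\<And>w. (k has_field_derivative k' w) (at w)" and k': "continuous_on UNIV k'"
    and a: "((\<lambda>t. V t y) has_vector_derivative a) (at 0)" and N: "0 \<le> N"
  shows "mollify N k a z = - mollify N k' y z +
    (cscale (k (of_real N - z)) (V N y) - cscale (k (of_real (-N) - z)) (V (-N) y))"
proof -
  have k0: "continuous_on UNIV k"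
    using k DERIV_isCont by (blast intro: continuous_at_imp_continuous_on)
  have "((\<lambda>u. cscale (k (of_real u - z)) (V u a) + cscale (k' (of_real u - z)) (V u y)) has_integral
      cscale (k (of_real N - z)) (V N y) - cscale (k (of_real (-N) - z)) (V (-N) y)) {-N..N}"
  proof (rule fundamental_theorem_of_calculus)
    fix u :: real
    have "((\<lambda>u. of_real u - z) has_vector_derivative 1) (at u)"
      by (auto intro!: derivative_eq_intros)
    from field_vector_diff_chain_at[OF this k]
    have "((\<lambda>u. k (of_real u - z)) has_vector_derivative k' (of_real u - z)) (at u)"
      by (simp add: o_def)
    from cscale.has_vector_derivative[OF this orbit_derivative[OF a]]
    show "((\<lambda>u. cscale (k (of_real u - z)) (V u y)) has_vector_derivative
      cscale (k (of_real u - z)) (V u a) + cscale (k' (of_real u - z)) (V u y)) (at u within {-N..N})"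
      by (rule has_vector_derivative_at_within)
  qed (use N in simp)
  then have "integral {-N..N} (\<lambda>u. cscale (k (of_real u - z)) (V u a) + cscale (k' (of_real u - z)) (V u y))
    = cscale (k (of_real N - z)) (V N y) - cscale (k (of_real (-N) - z)) (V (-N) y)"
    by (rule integral_unique)
  then show ?thesis
    unfolding mollify_def using integral_add[OF integrable_mollify[OF k0] integrable_mollify[OF k']]
    by (simp add: algebra_simps)
qed

lemma cpair_mollify_holomorphic:
  assumes k: "\<And>w. (k has_field_derivative k' w) (at w)" and k': "continuous_on UNIV k'"
  shows "(\<lambda>z. cpair x (mollify N k y z)) holomorphic_on S"
proof -
  have k0: "continuous_on UNIV k"
    using k DERIV_isCont by (blast intro: continuous_at_imp_continuous_on)
  have eq: "cpair x (mollify N k y z) = integral (cbox (-N) N) (\<lambda>u. k (of_real u - z) * cpair x (V u y))" for z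
    unfolding mollify_def
    using integral_linear[OF integrable_mollify[OF k0, of z y "-N" N] bounded_linear_cpair[of x]]
    by (simp add: o_def cpair_cscale)
  have "((\<lambda>z. integral (cbox (-N) N) (\<lambda>u. k (of_real u - z) * cpair x (V u y))) has_field_derivative
    integral (cbox (-N) N) (\<lambda>u. - k' (of_real u - z) * cpair x (V u y))) (at z within UNIV)" for z
  proof (rule leibniz_rule_field_derivative)
    fix z :: complex and u :: real
    show "((\<lambda>z. k (of_real u - z) * cpair x (V u y)) has_field_derivative
        - k' (of_real u - z) * cpair x (V u y)) (at z within UNIV)"
      by (auto intro!: derivative_eq_intros DERIV_chain2[OF k])
  next
    fix z show "(\<lambda>u. k (of_real u - z) * cpair x (V u y)) integrable_on cbox (-N) N"
      by (intro integrable_continuous continuous_intros continuous_on_compose2[OF k0]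
          cpair.continuous_on) auto
  next
    show "continuous_on (UNIV \<times> cbox (-N) N) (\<lambda>(z, u). - k' (of_real u - z) * cpair x (V u y))"
      unfolding split_beta
      by (intro continuous_intros continuous_on_compose2[OF k'] cpair.continuous_on) auto
  qed auto
  then show ?thesis
    unfolding eq by (meson field_differentiable_def
      holomorphic_on_def field_differentiable_at_within)
qed

end

section \<open>Gaussian kernels on a compact window\<close>

definition gauss_mass :: "nat \<Rightarrow> real" where
  "gauss_mass n = integral {-1..1} (\<lambda>v. exp (- (real n * v\<^sup>2)))"

definition gauss_kernel :: "nat \<Rightarrow> complex \<Rightarrow> complex" where
  "gauss_kernel n w = exp (- (of_nat n * w\<^sup>2)) / of_real (gauss_mass n)"

lemma gauss_integrable: "(\<lambda>v. exp (- (real n * v\<^sup>2))) integrable_on {a..b}"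
  by (intro integrable_continuous_interval continuous_intros)

text \<open>For \<open>\<bar>v\<bar> \<le> 1 / real n\<close> the exponent is at least -1, and this
  interval alone carries enough mass. The crude rate suffices because the inverse mass will multiply
  only exponentially small terms.\<close>

lemma gauss_mass_ge:
  assumes "n \<ge> 1"
  shows "1 / (2 * real n) \<le> gauss_mass n"
proof -
  have n: "real n \<ge> 1" using assms by simp
  have "1 / (2 * real n) \<le> 2 / real n * exp (-1)"
    using n exp_le by (simp add: exp_minus field_simps)
  also have "\<dots> = integral {-(1 / real n)..1 / real n} (\<lambda>v. exp (-1))"
    using n by simp
  also have "\<dots> \<le> integral {-(1 / real n)..1 / real n} (\<lambda>v. exp (- (real n * v\<^sup>2)))"
  proof (rule integral_le)
    fix v assume "v \<in> {-(1 / real n)..1 / real n}"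
    then have "\<bar>v\<bar> \<le> 1 / real n" by auto
    then have "v\<^sup>2 \<le> (1 / real n)\<^sup>2" by (metis abs_le_square_iff abs_ge_zero abs_of_nonneg order_trans)
    then have "real n * v\<^sup>2 \<le> real n * (1 / real n)\<^sup>2" by (intro mult_left_mono) auto
    also have "\<dots> \<le> 1" using n by (simp add: power2_eq_square)
    finally show "exp (-1) \<le> exp (- (real n * v\<^sup>2))" by simp
  qed (auto intro: gauss_integrable)
  also have "\<dots> \<le> gauss_mass n"
    unfolding gauss_mass_def using n
    by (intro integral_subset_le gauss_integrable) auto
  finally show ?thesis .
qed

lemma gauss_mass_pos: "n \<ge> 1 \<Longrightarrow> gauss_mass n > 0"
  by (rule less_le_trans[OF _ gauss_mass_ge]) simp_all

lemma inverse_gauss_mass_le: "n \<ge> 1 \<Longrightarrow> 1 / gauss_mass n \<le> 2 * real n"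
  using gauss_mass_ge[of n] gauss_mass_pos[of n] by (simp add: field_simps)

lemma gauss_kernel_derivative:
  "(gauss_kernel n has_field_derivative - (2 * of_nat n * w) * gauss_kernel n w) (at w)"
proof -
  have "((\<lambda>w. exp (- (of_nat n * w\<^sup>2))) has_field_derivative
      exp (- (of_nat n * w\<^sup>2)) * - (2 * of_nat n * w)) (at w)"
    by (auto intro!: derivative_eq_intros)
  from DERIV_cdivide[OF this] show ?thesis
    unfolding gauss_kernel_def[abs_def] by (simp add: mult.commute)
qed

lemma gauss_kernel_continuous: "continuous_on S (\<lambda>w. - (2 * of_nat n * w) * gauss_kernel n w)"
  and gauss_kernel_continuous': "continuous_on S (gauss_kernel n)"
proof -
  show 1: "continuous_on S (gauss_kernel n)"
    using gauss_kernel_derivative DERIV_isCont by (blast intro: continuous_at_imp_continuous_on)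
  show "continuous_on S (\<lambda>w. - (2 * of_nat n * w) * gauss_kernel n w)"
    by (intro continuous_intros 1)
qed

text \<open>Off the real axis the modulus is governed by \<open>Re (w\<^sup>2)\<close>. This
  controls the boundary terms of \<open>mollify_by_parts\<close>.\<close>

lemma cmod_gauss_kernel_le:
  assumes "n \<ge> 1" "Re (w\<^sup>2) \<ge> 1"
  shows "cmod (gauss_kernel n w) \<le> 2 * (real n * exp (- real n))"
proof -
  have "cmod (gauss_kernel n w) = exp (- (real n * Re (w\<^sup>2))) * (1 / gauss_mass n)"
    using gauss_mass_pos[OF assms(1)]
    by (simp add: gauss_kernel_def norm_divide)
  also have "\<dots> \<le> exp (- real n) * (2 * real n)"
    using assms gauss_mass_pos[OF assms(1)] inverse_gauss_mass_le[OF assms(1)]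
    by (intro mult_mono) auto
  finally show ?thesis by (simp add: mult_ac)
qed

lemma n_exp_tendsto_0:
  assumes "c > 0"
  shows "(\<lambda>n. real n * exp (- (real n * c))) \<longlonglongrightarrow> 0"
proof -
  have "exp (- (real n * c)) = exp (- c) ^ n" for n
    using exp_of_nat_mult[of n "- c"] by simp
  then show ?thesis
    using powser_times_n_limit_0[of "exp (- c)"] assms by simp
qed

text \<open>The kernel is normalized on \<open>{-1..1}\<close>; beyond it the integrand is at most
  \<open>exp (- real n)\<close>, so a larger window changes the mass by little.\<close>

lemma gauss_mass_enlarged:
  assumes "a \<le> -1" "1 \<le> b"
  shows "gauss_mass n \<le> integral {a..b} (\<lambda>v. exp (- (real n * v\<^sup>2)))"
    and "integral {a..b} (\<lambda>v. exp (- (real n * v\<^sup>2))) \<le> gauss_mass n + (b - a) * exp (- real n)"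
proof -
  let ?e = "\<lambda>v. exp (- (real n * v\<^sup>2))"
  show "gauss_mass n \<le> integral {a..b} ?e"
    unfolding gauss_mass_def using assms
    by (intro integral_subset_le gauss_integrable) auto
  have tail: "integral {c..d} ?e \<le> (d - c) * exp (- real n)"
    if "c \<le> d" "\<And>v. v \<in> {c..d} \<Longrightarrow> 1 \<le> \<bar>v\<bar>" for c d
  proof -
    have "integral {c..d} ?e \<le> integral {c..d} (\<lambda>_. exp (- real n))"
    proof (rule integral_le)
      fix v assume "v \<in> {c..d}"
      then have "1 \<le> v\<^sup>2" using that(2)[of v] abs_le_square_iff[of 1 v] by simp
      then show "?e v \<le> exp (- real n)" using mult_left_mono[of 1 "v\<^sup>2" "real n"] by simp
    qed (auto intro: gauss_integrable)
    then show ?thesis using that(1) by simp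
  qed
  have "integral {a..b} ?e = integral {a..-1} ?e + (integral {-1..1} ?e + integral {1..b} ?e)"
    using assms Henstock_Kurzweil_Integration.integral_combine[OF _ _ gauss_integrable, of a "-1" b n]
      Henstock_Kurzweil_Integration.integral_combine[OF _ _ gauss_integrable, of "-1" 1 b n] by simp
  also have "\<dots> \<le> (-1 - a) * exp (- real n) + (gauss_mass n + (b - 1) * exp (- real n))"
    unfolding gauss_mass_def using assms by (intro add_mono tail order_refl) auto
  also have "\<dots> \<le> gauss_mass n + (b - a) * exp (- real n)"
    by (simp add: algebra_simps)
  finally show "integral {a..b} ?e \<le> gauss_mass n + (b - a) * exp (- real n)" .
qed

section \<open>Convergence of the mollified orbits at real times\<close>

context unitary_flow begin

lemma norm_V_diff: "norm (V (v + t) y - V t y) = norm (V v y - y)"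
proof -
  have "V (v + t) y - V t y = V t (V v y - y)"
    by (metis V_add add.commute V.diff)
  then show ?thesis by simp
qed

text \<open>An approximate identity argument. For \<open>\<bar>v\<bar> < \<eta>\<close> the orbit
  moves by at most \<open>\<epsilon>\<close>; elsewhere the weight is at most
  \<open>exp (- (real n * \<eta>\<^sup>2))\<close>; a third term accounts for the mass of the window
  differing from \<open>gauss_mass n\<close>. By \<open>norm_V_diff\<close> the displacement does
  not depend on \<open>t\<close>.\<close>

lemma gauss_mollify_error:
  assumes n: "n \<ge> 1" and N: "\<bar>t\<bar> + 1 \<le> N" and \<eta>: "0 < \<eta>" "\<eta> \<le> 1" and \<epsilon>: "0 < \<epsilon>"
    and close: "\<And>v. \<bar>v\<bar> < \<eta> \<Longrightarrow> norm (V v y - y) \<le> \<epsilon>"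
  shows "norm (mollify N (gauss_kernel n) y (of_real t) - V t y)
    \<le> \<epsilon> + (4 * N * \<epsilon> + 12 * N * norm y) * (real n * exp (- (real n * \<eta>\<^sup>2)))"
proof -
  define e where "e = (\<lambda>v. exp (- (real n * v\<^sup>2)))"
  define G a b where "G = gauss_mass n" and "a = - N - t" and "b = N - t"
  define q where "q = exp (- (real n * \<eta>\<^sup>2))"
  have G: "G > 0" unfolding G_def by (rule gauss_mass_pos[OF n])
  have ab: "a \<le> -1" "1 \<le> b" "b - a = 2 * N" using N by (auto simp: a_def b_def)
  have "N \<ge> 0" using N by linarith
  \<comment> \<open>Here \<open>\<eta> \<le> 1\<close> lets the error of the normalization be
    absorbed into the same \<open>q\<close>.\<close>
  have eq: "exp (- real n) \<le> q"
    unfolding q_def using \<eta> mult_left_mono[of "\<eta>\<^sup>2" 1 "real n"] by (simp add: power_le_one)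
  have cont_e: "continuous_on {a..b} e"
    unfolding e_def by (intro continuous_intros)
  have "mollify N (gauss_kernel n) y (of_real t)
      = integral {-N..N} (\<lambda>u. (e (u - t) / G) *\<^sub>R V u y)"
    unfolding mollify_def
  proof (rule integral_cong)
    fix u
    have "gauss_kernel n (of_real u - of_real t) = of_real (e (u - t) / G)"
      by (simp add: gauss_kernel_def e_def G_def exp_of_real[symmetric])
    then show "cscale (gauss_kernel n (of_real u - of_real t)) (V u y) = (e (u - t) / G) *\<^sub>R V u y"
      by (simp only: cscale_of_real)
  qed
  also have "\<dots> = integral {a..b} (\<lambda>v. (e v / G) *\<^sub>R V (v + t) y)"
    unfolding a_def b_def
    using integral_shift_real_ivl[of "-N" t N "\<lambda>u. (e (u - t) / G) *\<^sub>R V u y"] by simp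
  also have "\<dots> = (1 / G) *\<^sub>R integral {a..b} (\<lambda>v. e v *\<^sub>R V (v + t) y)"
    by (subst integral_cmul[symmetric]) simp
  finally have Y: "G *\<^sub>R mollify N (gauss_kernel n) y (of_real t) = integral {a..b} (\<lambda>v. e v *\<^sub>R V (v + t) y)"
    using G by simp
  have int_e: "e integrable_on {a..b}" and int_eV: "(\<lambda>v. e v *\<^sub>R V (v + t) y) integrable_on {a..b}"
    and int_eV': "(\<lambda>v. e v *\<^sub>R (V (v + t) y - V t y)) integrable_on {a..b}"
    by (intro integrable_continuous_interval continuous_intros cont_e)+
  have int_c: "(\<lambda>v. e v *\<^sub>R V t y) integrable_on {a..b}"
    by (intro integrable_continuous_interval continuous_intros cont_e)
  have "integral {a..b} (\<lambda>v. e v *\<^sub>R (V (v + t) y - V t y))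
      = G *\<^sub>R mollify N (gauss_kernel n) y (of_real t) - integral {a..b} e *\<^sub>R V t y"
    unfolding Y scaleR_diff_right integral_diff[OF int_eV int_c]
    using integral_linear[OF int_e bounded_linear_scaleR_left, of "V t y"] by (simp add: o_def)
  then have split: "G *\<^sub>R (mollify N (gauss_kernel n) y (of_real t) - V t y)
      = integral {a..b} (\<lambda>v. e v *\<^sub>R (V (v + t) y - V t y)) + (integral {a..b} e - G) *\<^sub>R V t y"
    by (simp add: algebra_simps)
  have "norm (integral {a..b} (\<lambda>v. e v *\<^sub>R (V (v + t) y - V t y)))
      \<le> integral {a..b} (\<lambda>v. \<epsilon> * e v + 2 * norm y * q)"
  proof (rule integral_norm_bound_integral[OF int_eV'])
    show "(\<lambda>v. \<epsilon> * e v + 2 * norm y * q) integrable_on {a..b}"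
      by (intro integrable_continuous_interval continuous_intros cont_e)
    fix v
    have e0: "0 \<le> e v" by (simp add: e_def)
    show "norm (e v *\<^sub>R (V (v + t) y - V t y)) \<le> \<epsilon> * e v + 2 * norm y * q"
    proof (cases "\<bar>v\<bar> < \<eta>")
      case True
      then have "e v * norm (V v y - y) \<le> e v * \<epsilon>" using close e0 by (intro mult_left_mono) auto
      moreover have "0 \<le> 2 * norm y * q" by (simp add: q_def)
      ultimately show ?thesis using e0 by (simp add: norm_V_diff mult.commute)
    next
      case False
      then have "\<eta>\<^sup>2 \<le> v\<^sup>2" using \<eta> abs_le_square_iff[of \<eta> v] by simp
      then have "e v \<le> q" unfolding e_def q_def using mult_left_mono[of "\<eta>\<^sup>2" "v\<^sup>2" "real n"] by simp
      moreover have "norm (V v y - y) \<le> 2 * norm y"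
        using norm_triangle_ineq4[of "V v y" y] by simp
      ultimately have "e v * norm (V v y - y) \<le> q * (2 * norm y)"
        using e0 by (intro mult_mono) (auto simp: q_def)
      moreover have "0 \<le> \<epsilon> * e v" using e0 \<epsilon> by simp
      ultimately show ?thesis using e0 by (simp add: norm_V_diff mult.commute mult.left_commute)
    qed
  qed
  also have "\<dots> = \<epsilon> * integral {a..b} e + 4 * N * norm y * q"
  proof -
    have "integral {a..b} (\<lambda>v. \<epsilon> * e v + 2 * norm y * q)
        = integral {a..b} (\<lambda>v. \<epsilon> * e v) + integral {a..b} (\<lambda>_. 2 * norm y * q)"
      by (intro integral_add integrable_continuous_interval continuous_intros cont_e)
    also have "\<dots> = \<epsilon> * integral {a..b} e + (b - a) * (2 * norm y * q)"
      using ab by simp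
    finally show ?thesis unfolding ab(3) by (simp add: mult_ac)
  qed
  finally have 1: "norm (integral {a..b} (\<lambda>v. e v *\<^sub>R (V (v + t) y - V t y)))
      \<le> \<epsilon> * integral {a..b} e + 4 * N * norm y * q" .
  have Ge: "G \<le> integral {a..b} e" "integral {a..b} e \<le> G + 2 * N * q"
    using gauss_mass_enlarged[OF ab(1,2), of n] mult_left_mono[OF eq, of "2 * N"] \<open>N \<ge> 0\<close>
    unfolding e_def[symmetric] G_def[symmetric] ab(3) by linarith+
  have "norm (G *\<^sub>R (mollify N (gauss_kernel n) y (of_real t) - V t y))
      \<le> (\<epsilon> * integral {a..b} e + 4 * N * norm y * q) + (integral {a..b} e - G) * norm y"
    unfolding split using 1 Ge(1) by (intro norm_triangle_le add_mono) auto
  also have "\<dots> \<le> (\<epsilon> * (G + 2 * N * q) + 4 * N * norm y * q) + (2 * N * q) * norm y"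
  proof -
    have "\<epsilon> * integral {a..b} e \<le> \<epsilon> * (G + 2 * N * q)"
      using Ge(2) \<epsilon> by (intro mult_left_mono) auto
    moreover have "(integral {a..b} e - G) * norm y \<le> (2 * N * q) * norm y"
      using Ge(2) by (intro mult_right_mono) auto
    ultimately show ?thesis by linarith
  qed
  also have "\<dots> = G * \<epsilon> + (2 * N * \<epsilon> + 6 * N * norm y) * q"
    by (simp add: algebra_simps)
  also have "\<dots> = G * (\<epsilon> + (2 * N * \<epsilon> + 6 * N * norm y) * q * (1 / G))"
    using G by (subst distrib_left) simp
  finally have "norm (mollify N (gauss_kernel n) y (of_real t) - V t y)
      \<le> \<epsilon> + (2 * N * \<epsilon> + 6 * N * norm y) * q * (1 / G)"
    using G by (simp only: norm_scaleR abs_of_pos mult_le_cancel_left_pos)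
  \<comment> \<open>Dividing by the mass costs at most \<open>2 * real n\<close>, the source of the
    factor \<open>real n\<close> in the statement.\<close>
  also have "\<dots> \<le> \<epsilon> + (2 * N * \<epsilon> + 6 * N * norm y) * q * (2 * real n)"
    using inverse_gauss_mass_le[OF n] \<epsilon> \<open>N \<ge> 0\<close>
    by (intro add_left_mono mult_left_mono) (auto simp: G_def q_def)
  finally show ?thesis by (simp add: q_def algebra_simps)
qed

lemma gauss_mollify_tendsto:
  assumes N: "R + 1 \<le> N" and R: "0 \<le> R"
  shows "uniform_limit {-R..R} (\<lambda>n t. mollify N (gauss_kernel n) y (of_real t)) (\<lambda>t. V t y) sequentially"
proof (rule uniform_limitI)
  fix \<epsilon> :: real assume \<epsilon>: "\<epsilon> > 0"
  have "isCont (\<lambda>t. V t y) 0"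
    using continuous_V continuous_on_eq_continuous_at open_UNIV by blast
  then obtain \<eta> where \<eta>: "0 < \<eta>" "\<And>v. \<bar>v\<bar> < \<eta> \<Longrightarrow> norm (V v y - y) < \<epsilon> / 2"
    unfolding continuous_at_eps_delta using \<epsilon>
    by (metis dist_norm V_0 diff_zero half_gt_zero real_norm_def)
  define \<theta> where "\<theta> = min \<eta> 1"
  have \<theta>: "0 < \<theta>" "\<theta> \<le> 1" "\<And>v. \<bar>v\<bar> < \<theta> \<Longrightarrow> norm (V v y - y) \<le> \<epsilon> / 2"
    using \<eta> by (auto simp: \<theta>_def less_imp_le)
  define C where "C = 4 * N * (\<epsilon> / 2) + 12 * N * norm y"
  have "(\<lambda>n. C * (real n * exp (- (real n * \<theta>\<^sup>2)))) \<longlonglongrightarrow> C * 0"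
    using \<theta> by (intro tendsto_mult n_exp_tendsto_0) auto
  then have "\<forall>\<^sub>F n in sequentially. C * (real n * exp (- (real n * \<theta>\<^sup>2))) < \<epsilon> / 2"
    using \<epsilon> by (intro order_tendstoD(2)) auto
  then show "\<forall>\<^sub>F n in sequentially. \<forall>t\<in>{-R..R}.
      dist (mollify N (gauss_kernel n) y (of_real t)) (V t y) < \<epsilon>"
    using eventually_ge_at_top[of 1]
  proof eventually_elim
    case (elim n)
    show ?case
    proof
      fix t assume "t \<in> {-R..R}"
      then have "\<bar>t\<bar> + 1 \<le> N" using N by auto
      from gauss_mollify_error[OF elim(2) this \<theta>(1,2) _ \<theta>(3)] \<epsilon> elim(1)
      show "dist (mollify N (gauss_kernel n) y (of_real t)) (V t y) < \<epsilon>"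
        by (simp add: dist_norm C_def)
    qed
  qed
qed

end

section \<open>Positive energy\<close>

locale positive_energy_flow = unitary_flow +
  fixes m :: real
  assumes m: "m > 0" and gen: "generator_bounded_below J V m"
begin

text \<open>Since \<open>D s + B s\<close> is \<open>i Q (Y s)\<close>, the derivative
  \<open>J (D s)\<close> is \<open>- Q (Y s) - J (B s)\<close>. Hence the squared norm has
  derivative at most \<open>- 2 * m * n\<^sup>2 + 2 * \<eta> * n\<close> with
  \<open>n = norm (Y s)\<close>, and Gronwall's argument applies.\<close>

lemma energy_estimate:
  assumes S: "0 \<le> S" and \<eta>: "0 \<le> \<eta>" "\<eta> \<le> 2 * m"
    and Y: "\<And>s. 0 \<le> s \<Longrightarrow> s \<le> S \<Longrightarrow> (Y has_vector_derivative J (D s)) (at s)"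
    and orbit: "\<And>s. 0 \<le> s \<Longrightarrow> s \<le> S \<Longrightarrow> ((\<lambda>t. V t (Y s)) has_vector_derivative D s + B s) (at 0)"
    and B: "\<And>s. 0 \<le> s \<Longrightarrow> s \<le> S \<Longrightarrow> norm (B s) \<le> \<eta>"
  shows "(norm (Y S))\<^sup>2 \<le> exp (- (2 * m - \<eta>) * S) * (norm (Y 0))\<^sup>2 + \<eta> * S"
proof -
  define \<kappa> where "\<kappa> = 2 * m - \<eta>"
  \<comment> \<open>The integrating factor for decay rate \<open>\<kappa>\<close>; subtracting
    \<open>\<eta> * s\<close> absorbs the constant part of the error and makes \<open>\<psi>\<close>
    nonincreasing.\<close>
  define \<psi> where "\<psi> = (\<lambda>s. exp (\<kappa> * s) * (inner (Y s) (Y s) - \<eta> * s))"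
  have "\<psi> S \<le> \<psi> 0"
  proof (rule DERIV_nonpos_imp_nonincreasing[OF S])
    fix s assume s: "0 \<le> s" "s \<le> S"
    let ?d = "\<kappa> * exp (\<kappa> * s) * (inner (Y s) (Y s) - \<eta> * s)
      + exp (\<kappa> * s) * (2 * inner (Y s) (J (D s)) - \<eta>)"
    have "((\<lambda>s. inner (Y s) (Y s)) has_vector_derivative
        inner (Y s) (J (D s)) + inner (J (D s)) (Y s)) (at s)"
      by (rule bounded_bilinear.has_vector_derivative[OF bounded_bilinear_inner Y[OF s] Y[OF s]])
    then have "((\<lambda>s. inner (Y s) (Y s)) has_real_derivative 2 * inner (Y s) (J (D s))) (at s)"
      by (simp add: has_real_derivative_iff_has_vector_derivative inner_commute)
    then have "(\<psi> has_real_derivative ?d) (at s)"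
      unfolding \<psi>_def by (auto intro!: derivative_eq_intros simp: algebra_simps)
    moreover have "?d \<le> 0"
    proof -
      define n where "n = norm (Y s)"
      have "m * n\<^sup>2 \<le> inner (Y s) (- J (D s + B s))"
        using gen orbit[OF s] unfolding generator_bounded_below_def n_def by blast
      then have 1: "2 * inner (Y s) (J (D s)) \<le> - (2 * (m * n\<^sup>2)) - 2 * inner (Y s) (J (B s))"
        by (simp add: J.add inner_add_right inner_diff_right)
      have "- inner (Y s) (J (B s)) \<le> norm (Y s) * norm (J (B s))"
        using Cauchy_Schwarz_ineq2[of "Y s" "J (B s)"] by linarith
      also have "\<dots> \<le> n * \<eta>" unfolding n_def using B[OF s] by (intro mult_mono) auto
      finally have 2: "- inner (Y s) (J (B s)) \<le> n * \<eta>" .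
      \<comment> \<open>The error linear in \<open>n\<close> is traded for a loss of
        \<open>\<eta>\<close> in the decay rate and an additive \<open>\<eta>\<close>.\<close>
      have "0 \<le> \<eta> * (n - 1)\<^sup>2" using \<eta> by simp
      then have "2 * (n * \<eta>) \<le> \<eta> * n\<^sup>2 + \<eta>" by (simp add: power2_eq_square algebra_simps)
      with 1 2 have "2 * inner (Y s) (J (D s)) \<le> - \<kappa> * n\<^sup>2 + \<eta>"
        by (simp add: \<kappa>_def left_diff_distrib)
      moreover have "0 \<le> \<kappa> * (\<eta> * s)" using \<eta> s by (simp add: \<kappa>_def)
      ultimately have "\<kappa> * (n\<^sup>2 - \<eta> * s) + (2 * inner (Y s) (J (D s)) - \<eta>) \<le> 0"
        by (simp add: algebra_simps)
      then have "exp (\<kappa> * s) * (\<kappa> * (n\<^sup>2 - \<eta> * s) + (2 * inner (Y s) (J (D s)) - \<eta>)) \<le> 0"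
        by (simp add: mult_le_0_iff)
      then show ?thesis
        unfolding n_def power2_norm_eq_inner by (simp add: algebra_simps)
    qed
    ultimately show "\<exists>d. (\<psi> has_real_derivative d) (at s) \<and> d \<le> 0" by blast
  qed
  then have "exp (\<kappa> * S) * ((norm (Y S))\<^sup>2 - \<eta> * S) \<le> (norm (Y 0))\<^sup>2"
    by (simp add: \<psi>_def power2_norm_eq_inner)
  then have "exp (- \<kappa> * S) * (exp (\<kappa> * S) * ((norm (Y S))\<^sup>2 - \<eta> * S)) \<le> exp (- \<kappa> * S) * (norm (Y 0))\<^sup>2"
    by (rule mult_left_mono) simp
  also have "exp (- \<kappa> * S) * (exp (\<kappa> * S) * ((norm (Y S))\<^sup>2 - \<eta> * S)) = (norm (Y S))\<^sup>2 - \<eta> * S"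
    by (simp add: exp_minus)
  finally show ?thesis unfolding \<kappa>_def by linarith
qed

text \<open>The window radius \<open>2 R + 1\<close> gives \<open>Re (w\<^sup>2) \<ge> 1\<close> for every difference \<open>w\<close> of an end point of
  the window and a point of the square of radius \<open>R\<close>, so that cutting off the Gaussian costs only
  boundary terms of order \<open>n exp (- n)\<close>.\<close>

definition gauss_orbit :: "real \<Rightarrow> 'a \<Rightarrow> nat \<Rightarrow> complex \<Rightarrow> 'a" where
  "gauss_orbit R y n z = mollify (2 * R + 1) (gauss_kernel n) y z"

text \<open>Two boundary terms, each at most
  \<open>2 * (real n * exp (- real n)) * norm y\<close>.\<close>

definition gauss_defect :: "'a \<Rightarrow> nat \<Rightarrow> real" where
  "gauss_defect y n = 4 * norm y * (real n * exp (- real n))"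

lemma gauss_defect_nonneg: "0 \<le> gauss_defect y n"
  by (simp add: gauss_defect_def)

lemma gauss_defect_tendsto: "gauss_defect y \<longlonglongrightarrow> 0"
proof -
  have "(\<lambda>n. 4 * norm y * (real n * exp (- (real n * 1)))) \<longlonglongrightarrow> 4 * norm y * 0"
    by (intro tendsto_mult tendsto_const n_exp_tendsto_0) simp
  then show ?thesis by (simp add: gauss_defect_def[abs_def])
qed

text \<open>Supplies the data of \<open>energy_estimate\<close>: \<open>D\<close> is minus the orbit
  mollified by the derivative of the kernel, \<open>B\<close> collects the boundary terms. Both are
  functions of \<open>z\<close>, so every vertical segment of the square can be treated.\<close>

lemma gauss_orbit_flow:
  assumes R: "0 \<le> R" and n: "n \<ge> 1" and a: "((\<lambda>t. V t y) has_vector_derivative a) (at 0)"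
  obtains D B where
    "\<And>z s. ((\<lambda>s. gauss_orbit R y n (z + \<i> * of_real s)) has_vector_derivative J (D (z + \<i> * of_real s))) (at s)"
    "\<And>z. ((\<lambda>t. V t (gauss_orbit R y n z)) has_vector_derivative D z + B z) (at 0)"
    "\<And>z. \<bar>Re z\<bar> \<le> R \<Longrightarrow> \<bar>Im z\<bar> \<le> R \<Longrightarrow> norm (B z) \<le> gauss_defect y n"
proof
  let ?N = "2 * R + 1" and ?k = "gauss_kernel n" and ?k' = "\<lambda>w. - (2 * of_nat n * w) * gauss_kernel n w"
  define B where "B = (\<lambda>z. cscale (?k (of_real ?N - z)) (V ?N y) - cscale (?k (of_real (- ?N) - z)) (V (- ?N) y))"
  show "((\<lambda>s. gauss_orbit R y n (z + \<i> * of_real s)) has_vector_derivative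
      J (- mollify ?N ?k' y (z + \<i> * of_real s))) (at s)" for z s
    unfolding gauss_orbit_def
    by (rule mollify_imaginary_derivative[OF gauss_kernel_derivative gauss_kernel_continuous])
  have parts: "mollify ?N ?k a z = - mollify ?N ?k' y z + B z" for z
    unfolding B_def using R
    by (intro mollify_by_parts gauss_kernel_derivative gauss_kernel_continuous a) simp
  show "((\<lambda>t. V t (gauss_orbit R y n z)) has_vector_derivative - mollify ?N ?k' y z + B z) (at 0)" for z
    unfolding gauss_orbit_def parts[symmetric]
    by (rule mollify_orbit_derivative[OF gauss_kernel_continuous' a])
  fix z assume z: "\<bar>Re z\<bar> \<le> R" "\<bar>Im z\<bar> \<le> R"
  have k: "cmod (?k (of_real c - z)) \<le> 2 * (real n * exp (- real n))" if "\<bar>c\<bar> = ?N" for c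
  proof (rule cmod_gauss_kernel_le[OF n])
    \<comment> \<open>The real part of the difference is at least \<open>(2 * R + 1) - R\<close> in
      modulus, the imaginary part at most \<open>R\<close>.\<close>
    have "(R + 1)\<^sup>2 \<le> \<bar>c - Re z\<bar>\<^sup>2" using z R that by (intro power_mono) auto
    moreover have "\<bar>Im z\<bar>\<^sup>2 \<le> R\<^sup>2" using z by (intro power_mono) auto
    ultimately have "(R + 1)\<^sup>2 - R\<^sup>2 \<le> (c - Re z)\<^sup>2 - (Im z)\<^sup>2" by simp
    moreover have "1 \<le> (R + 1)\<^sup>2 - R\<^sup>2" using R by (simp add: power2_eq_square algebra_simps)
    moreover have "Re ((of_real c - z)\<^sup>2) = (c - Re z)\<^sup>2 - (Im z)\<^sup>2"
      by (simp add: power2_eq_square)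
    ultimately show "1 \<le> Re ((of_real c - z)\<^sup>2)" by linarith
  qed
  have "norm (B z) \<le> norm (cscale (?k (of_real ?N - z)) (V ?N y)) + norm (cscale (?k (of_real (- ?N) - z)) (V (- ?N) y))"
    unfolding B_def by (rule norm_triangle_ineq4)
  also have "\<dots> = cmod (?k (of_real ?N - z)) * norm y + cmod (?k (of_real (- ?N) - z)) * norm y"
    by (simp only: norm_cscale norm_V)
  also have "\<dots> \<le> 2 * (real n * exp (- real n)) * norm y + 2 * (real n * exp (- real n)) * norm y"
    using R by (intro add_mono mult_right_mono k) auto
  also have "\<dots> = gauss_defect y n" by (simp add: gauss_defect_def)
  finally show "norm (B z) \<le> gauss_defect y n" .
qed

lemma gauss_orbit_decay:
  assumes n: "n \<ge> 1" and a: "((\<lambda>t. V t y) has_vector_derivative a) (at 0)"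
    and t: "\<bar>t\<bar> \<le> R" and s: "0 \<le> s" "s \<le> R" and small: "gauss_defect y n \<le> 2 * m"
  shows "(norm (gauss_orbit R y n (of_real t + \<i> * of_real s)))\<^sup>2
    \<le> exp (- (2 * m - gauss_defect y n) * s) * (norm (gauss_orbit R y n (of_real t)))\<^sup>2 + gauss_defect y n * s"
proof -
  have R: "0 \<le> R" using t by linarith
  obtain D B where DB:
    "\<And>z s. ((\<lambda>s. gauss_orbit R y n (z + \<i> * of_real s)) has_vector_derivative J (D (z + \<i> * of_real s))) (at s)"
    "\<And>z. ((\<lambda>t. V t (gauss_orbit R y n z)) has_vector_derivative D z + B z) (at 0)"
    "\<And>z. \<bar>Re z\<bar> \<le> R \<Longrightarrow> \<bar>Im z\<bar> \<le> R \<Longrightarrow> norm (B z) \<le> gauss_defect y n"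
    using gauss_orbit_flow[OF R n a] by blast
  show ?thesis
    using energy_estimate[OF s(1) gauss_defect_nonneg small, of "\<lambda>s. gauss_orbit R y n (of_real t + \<i> * of_real s)"
        "\<lambda>s. D (of_real t + \<i> * of_real s)" "\<lambda>s. B (of_real t + \<i> * of_real s)", OF DB(1,2) DB(3)] t s
    by simp
qed

text \<open>The difference of two Gaussian orbits solves the same equation by linearity, with the
  defects added. The energy estimate therefore carries closeness at real times up into the half
  plane.\<close>

lemma gauss_orbit_Cauchy:
  assumes n: "n \<ge> 1" "k \<ge> 1" and a: "((\<lambda>t. V t y) has_vector_derivative a) (at 0)"
    and t: "\<bar>t\<bar> \<le> R" and s: "0 \<le> s" "s \<le> R" and small: "gauss_defect y n + gauss_defect y k \<le> 2 * m"
  shows "(norm (gauss_orbit R y n (of_real t + \<i> * of_real s) - gauss_orbit R y k (of_real t + \<i> * of_real s)))\<^sup>2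
    \<le> (norm (gauss_orbit R y n (of_real t) - gauss_orbit R y k (of_real t)))\<^sup>2
      + (gauss_defect y n + gauss_defect y k) * R"
proof -
  have R: "0 \<le> R" using t by linarith
  define \<eta> where "\<eta> = gauss_defect y n + gauss_defect y k"
  have \<eta>: "0 \<le> \<eta>" "\<eta> \<le> 2 * m"
    using small gauss_defect_nonneg[of y] by (auto simp: \<eta>_def intro: add_nonneg_nonneg)
  define w where "w = (\<lambda>s. of_real t + \<i> * of_real s)"
  define Y where "Y = (\<lambda>s. gauss_orbit R y n (w s) - gauss_orbit R y k (w s))"
  obtain D B where DB:
    "\<And>z s. ((\<lambda>s. gauss_orbit R y n (z + \<i> * of_real s)) has_vector_derivative J (D (z + \<i> * of_real s))) (at s)"
    "\<And>z. ((\<lambda>t. V t (gauss_orbit R y n z)) has_vector_derivative D z + B z) (at 0)"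
    "\<And>z. \<bar>Re z\<bar> \<le> R \<Longrightarrow> \<bar>Im z\<bar> \<le> R \<Longrightarrow> norm (B z) \<le> gauss_defect y n"
    using gauss_orbit_flow[OF R n(1) a] by blast
  obtain D' B' where DB':
    "\<And>z s. ((\<lambda>s. gauss_orbit R y k (z + \<i> * of_real s)) has_vector_derivative J (D' (z + \<i> * of_real s))) (at s)"
    "\<And>z. ((\<lambda>t. V t (gauss_orbit R y k z)) has_vector_derivative D' z + B' z) (at 0)"
    "\<And>z. \<bar>Re z\<bar> \<le> R \<Longrightarrow> \<bar>Im z\<bar> \<le> R \<Longrightarrow> norm (B' z) \<le> gauss_defect y k"
    using gauss_orbit_flow[OF R n(2) a] by blast
  have "(norm (Y s))\<^sup>2 \<le> exp (- (2 * m - \<eta>) * s) * (norm (Y 0))\<^sup>2 + \<eta> * s"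
  proof (rule energy_estimate[OF s(1) \<eta>])
    fix r assume r: "0 \<le> r" "r \<le> s"
    show "(Y has_vector_derivative J (D (w r) - D' (w r))) (at r)"
      unfolding Y_def w_def J.diff by (intro has_vector_derivative_diff DB(1) DB'(1))
    have "((\<lambda>t. V t (Y r)) has_vector_derivative (D (w r) + B (w r)) - (D' (w r) + B' (w r))) (at 0)"
      unfolding Y_def V.diff by (intro has_vector_derivative_diff DB(2) DB'(2))
    then show "((\<lambda>t. V t (Y r)) has_vector_derivative (D (w r) - D' (w r)) + (B (w r) - B' (w r))) (at 0)"
      by (simp add: algebra_simps)
    have "norm (B (w r)) \<le> gauss_defect y n" "norm (B' (w r)) \<le> gauss_defect y k"
      using r s t by (auto intro!: DB(3) DB'(3) simp: w_def)
    then show "norm (B (w r) - B' (w r)) \<le> \<eta>"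
      unfolding \<eta>_def using norm_triangle_ineq4[of "B (w r)" "B' (w r)"] by linarith
  qed
  also have "\<dots> \<le> 1 * (norm (Y 0))\<^sup>2 + \<eta> * R"
    using \<eta> s by (intro add_mono mult_right_mono mult_left_mono) (auto simp: mult_nonpos_nonneg)
  finally show ?thesis by (simp add: Y_def w_def \<eta>_def)
qed

section \<open>Uniform convergence and analytic extension of the orbit\<close>

definition half_square :: "real \<Rightarrow> complex set" where
  "half_square R = {z. \<bar>Re z\<bar> \<le> R \<and> 0 \<le> Im z \<and> Im z \<le> R}"

lemma gauss_orbit_real_tendsto:
  assumes "0 \<le> R"
  shows "uniform_limit {-R..R} (\<lambda>n t. gauss_orbit R y n (of_real t)) (\<lambda>t. V t y) sequentially"
  unfolding gauss_orbit_def using assms by (intro gauss_mollify_tendsto) auto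

lemma gauss_orbit_convergent:
  assumes R: "0 \<le> R" and a: "((\<lambda>t. V t y) has_vector_derivative a) (at 0)"
  shows "uniformly_convergent_on (half_square R) (gauss_orbit R y)"
proof (rule Cauchy_uniformly_convergent, rule uniformly_Cauchy_onI)
  fix \<epsilon> :: real assume \<epsilon>: "\<epsilon> > 0"
  \<comment> \<open>The first entry keeps \<open>gauss_orbit_Cauchy\<close> applicable, the second
    makes the defect term at most \<open>\<epsilon>\<^sup>2 / 2\<close>. Together with
    \<open>(\<epsilon> / 2)\<^sup>2\<close> from the real axis this stays below
    \<open>\<epsilon>\<^sup>2\<close>; \<open>R + 1\<close> avoids division by zero.\<close>
  define \<gamma> where "\<gamma> = min (2 * m) (\<epsilon>\<^sup>2 / (2 * (R + 1)))"
  have \<gamma>: "\<gamma> > 0" using m \<epsilon> R by (simp add: \<gamma>_def)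
  have "\<forall>\<^sub>F n in sequentially. gauss_defect y n < \<gamma> / 2"
    using order_tendstoD(2)[OF gauss_defect_tendsto, of "\<gamma> / 2"] \<gamma> by simp
  moreover have "\<forall>\<^sub>F n in sequentially. \<forall>t\<in>{-R..R}. dist (gauss_orbit R y n (of_real t)) (V t y) < \<epsilon> / 4"
    by (rule uniform_limitD[OF gauss_orbit_real_tendsto[OF R]]) (use \<epsilon> in simp)
  ultimately have "\<forall>\<^sub>F n in sequentially. 1 \<le> n \<and> gauss_defect y n < \<gamma> / 2 \<and>
      (\<forall>t\<in>{-R..R}. dist (gauss_orbit R y n (of_real t)) (V t y) < \<epsilon> / 4)"
    using eventually_ge_at_top[of "1::nat"] by eventually_elim blast
  then obtain M where M: "\<And>n. n \<ge> M \<Longrightarrow> 1 \<le> n" "\<And>n. n \<ge> M \<Longrightarrow> gauss_defect y n < \<gamma> / 2"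
    "\<And>n t. n \<ge> M \<Longrightarrow> t \<in> {-R..R} \<Longrightarrow> dist (gauss_orbit R y n (of_real t)) (V t y) < \<epsilon> / 4"
    unfolding eventually_sequentially by blast
  have "dist (gauss_orbit R y n z) (gauss_orbit R y k z) < \<epsilon>"
    if z: "z \<in> half_square R" and n: "n \<ge> M" and k: "k \<ge> M" for z n k
  proof -
    define t s where "t = Re z" and "s = Im z"
    have zts: "z = of_real t + \<i> * of_real s" by (simp add: t_def s_def complex_eq_iff)
    have ts: "\<bar>t\<bar> \<le> R" "0 \<le> s" "s \<le> R" using z by (auto simp: half_square_def t_def s_def)
    have sum: "gauss_defect y n + gauss_defect y k < \<gamma>" using M(2)[OF n] M(2)[OF k] by linarith
    have "dist (gauss_orbit R y n (of_real t)) (gauss_orbit R y k (of_real t)) \<le> \<epsilon> / 4 + \<epsilon> / 4"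
      using M(3)[OF n, of t] M(3)[OF k, of t] ts(1)
        dist_triangle2[of "gauss_orbit R y n (of_real t)" "gauss_orbit R y k (of_real t)" "V t y"]
      by (simp add: abs_le_iff)
    then have "norm (gauss_orbit R y n (of_real t) - gauss_orbit R y k (of_real t)) \<le> \<epsilon> / 2"
      by (simp add: dist_norm)
    then have 1: "(norm (gauss_orbit R y n (of_real t) - gauss_orbit R y k (of_real t)))\<^sup>2 \<le> (\<epsilon> / 2)\<^sup>2"
      by (intro power_mono) auto
    have "(gauss_defect y n + gauss_defect y k) * R \<le> \<gamma> * (R + 1)"
      using sum R gauss_defect_nonneg[of y] \<gamma> by (intro mult_mono) auto
    also have "\<dots> \<le> \<epsilon>\<^sup>2 / (2 * (R + 1)) * (R + 1)"
      using R by (intro mult_right_mono) (auto simp: \<gamma>_def)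
    also have "\<dots> = \<epsilon>\<^sup>2 / 2" using R by (simp add: field_simps)
    finally have 2: "(gauss_defect y n + gauss_defect y k) * R \<le> \<epsilon>\<^sup>2 / 2" .
    have "(norm (gauss_orbit R y n z - gauss_orbit R y k z))\<^sup>2 \<le> (\<epsilon> / 2)\<^sup>2 + \<epsilon>\<^sup>2 / 2"
      using gauss_orbit_Cauchy[OF M(1)[OF n] M(1)[OF k] a ts] sum 1 2
      unfolding zts \<gamma>_def by linarith
    also have "\<dots> < \<epsilon>\<^sup>2" using \<epsilon> by (simp add: power_divide)
    finally show ?thesis
      using \<epsilon> by (simp add: dist_norm power2_less_imp_less)
  qed
  then show "\<exists>M. \<forall>z\<in>half_square R. \<forall>n\<ge>M. \<forall>k\<ge>M. dist (gauss_orbit R y n z) (gauss_orbit R y k z) < \<epsilon>"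
    by blast
qed

text \<open>The limit of the Gaussian orbits plays the role of \<open>exp (i z Q) y\<close>.\<close>

lemma orbit_extension:
  assumes R: "0 < R" and a: "((\<lambda>t. V t y) has_vector_derivative a) (at 0)"
  obtains F where
    "F holomorphic_on {z. \<bar>Re z\<bar> < R \<and> 0 < Im z \<and> Im z < R}"
    "continuous_on {z. \<bar>Re z\<bar> < R \<and> 0 \<le> Im z \<and> Im z < R} F"
    "\<And>t. \<bar>t\<bar> \<le> R \<Longrightarrow> F (of_real t) = cpair x (V t y)"
    "\<And>z. \<bar>Re z\<bar> < R \<Longrightarrow> 0 \<le> Im z \<Longrightarrow> Im z < R \<Longrightarrow> cmod (F z) \<le> norm x * norm y * exp (- m * Im z)"
proof -
  have R0: "0 \<le> R" using R by simp
  obtain Y where Y: "uniform_limit (half_square R) (gauss_orbit R y) Y sequentially"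
    using gauss_orbit_convergent[OF R0 a] unfolding uniformly_convergent_on_def by blast
  define F where "F = (\<lambda>z. cpair x (Y z))"
  have F: "uniform_limit (half_square R) (\<lambda>n z. cpair x (gauss_orbit R y n z)) F sequentially"
    unfolding F_def by (rule bounded_linear.uniform_limit[OF bounded_linear_cpair Y])
  have hol: "(\<lambda>z. cpair x (gauss_orbit R y n z)) holomorphic_on S" for n S
    unfolding gauss_orbit_def
    by (rule cpair_mollify_holomorphic[OF gauss_kernel_derivative gauss_kernel_continuous])
  have lim: "(\<lambda>n. gauss_orbit R y n z) \<longlonglongrightarrow> Y z" if "z \<in> half_square R" for z
    using tendsto_uniform_limitI[OF Y that] .
  have real: "Y (of_real t) = V t y" if "\<bar>t\<bar> \<le> R" for t
  proof (rule LIMSEQ_unique)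
    show "(\<lambda>n. gauss_orbit R y n (of_real t)) \<longlonglongrightarrow> Y (of_real t)"
      using that R by (intro lim) (simp add: half_square_def)
    show "(\<lambda>n. gauss_orbit R y n (of_real t)) \<longlonglongrightarrow> V t y"
      using that by (intro tendsto_uniform_limitI[OF gauss_orbit_real_tendsto[OF R0]]) auto
  qed
  show thesis
  proof
    show "F holomorphic_on {z. \<bar>Re z\<bar> < R \<and> 0 < Im z \<and> Im z < R}" (is "_ holomorphic_on ?S")
    proof (rule holomorphic_uniform_sequence)
      show op: "open ?S"
        by (intro open_Collect_conj open_Collect_less continuous_intros)
      fix z assume "z \<in> ?S"
      then obtain d where d: "d > 0" "cball z d \<subseteq> ?S"
        using op open_contains_cball by blast
      moreover have "cball z d \<subseteq> half_square R" using d(2) by (force simp: half_square_def)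
      ultimately show "\<exists>d>0. cball z d \<subseteq> ?S \<and>
          uniform_limit (cball z d) (\<lambda>n z. cpair x (gauss_orbit R y n z)) F sequentially"
        using uniform_limit_on_subset[OF F] by blast
    qed (rule hol)
    have "continuous_on (half_square R) F"
      by (rule uniform_limit_theorem[OF _ F])
        (auto intro!: always_eventually holomorphic_on_imp_continuous_on hol)
    then show "continuous_on {z. \<bar>Re z\<bar> < R \<and> 0 \<le> Im z \<and> Im z < R} F"
      by (rule continuous_on_subset) (auto simp: half_square_def)
    show "F (of_real t) = cpair x (V t y)" if "\<bar>t\<bar> \<le> R" for t
      using real[OF that] by (simp add: F_def)
    fix z assume z: "\<bar>Re z\<bar> < R" "0 \<le> Im z" "Im z < R"
    define t s where "t = Re z" and "s = Im z"
    have zts: "z = of_real t + \<i> * of_real s" by (simp add: t_def s_def complex_eq_iff)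
    have ts: "\<bar>t\<bar> \<le> R" "0 \<le> s" "s \<le> R" using z by (auto simp: t_def s_def)
    \<comment> \<open>The limit of \<open>gauss_orbit_decay\<close>: the zeros stand where the
      defect was, and the value on the real axis is \<open>V t y\<close>, of norm
      \<open>norm y\<close>.\<close>
    have "(norm (Y z))\<^sup>2 \<le> exp (- (2 * m - 0) * s) * (norm (Y (of_real t)))\<^sup>2 + 0 * s"
    proof (rule tendsto_le[OF sequentially_bot])
      show "(\<lambda>n. (norm (gauss_orbit R y n z))\<^sup>2) \<longlonglongrightarrow> (norm (Y z))\<^sup>2"
        using z by (intro tendsto_intros lim) (simp add: half_square_def)
      show "(\<lambda>n. exp (- (2 * m - gauss_defect y n) * s) * (norm (gauss_orbit R y n (of_real t)))\<^sup>2
          + gauss_defect y n * s) \<longlonglongrightarrow> exp (- (2 * m - 0) * s) * (norm (Y (of_real t)))\<^sup>2 + 0 * s"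
        using ts R by (intro tendsto_intros lim gauss_defect_tendsto) (simp add: half_square_def)
      have "\<forall>\<^sub>F n in sequentially. gauss_defect y n < 2 * m"
        using order_tendstoD(2)[OF gauss_defect_tendsto, of "2 * m"] m by simp
      then show "\<forall>\<^sub>F n in sequentially. (norm (gauss_orbit R y n z))\<^sup>2
        \<le> exp (- (2 * m - gauss_defect y n) * s) * (norm (gauss_orbit R y n (of_real t)))\<^sup>2 + gauss_defect y n * s"
        using eventually_ge_at_top[of "1::nat"]
      proof eventually_elim
        case (elim n)
        then show ?case unfolding zts using gauss_orbit_decay[OF elim(2) a ts] by simp
      qed
    qed
    also have "\<dots> = (exp (- m * s) * norm y)\<^sup>2"
      using real[OF ts(1)] by (simp add: power_mult_distrib power2_eq_square exp_add[symmetric])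
    finally have "norm (Y z) \<le> exp (- m * s) * norm y"
      by (rule power2_le_imp_le) simp
    then have "norm x * norm (Y z) \<le> norm x * (exp (- m * s) * norm y)"
      by (rule mult_left_mono) simp
    with cmod_cpair_le[of x "Y z"]
    have "cmod (F z) \<le> norm x * (exp (- m * s) * norm y)"
      unfolding F_def by linarith
    then show "cmod (F z) \<le> norm x * norm y * exp (- m * Im z)"
      by (simp add: s_def mult_ac)
  qed
qed

text \<open>The symplectic condition makes the extended pairing real on the interval, so
  \<open>reflected_strip_bound\<close> applies for each \<open>r < 1\<close>; then \<open>r\<close>
  tends to 1.\<close>

lemma smooth_inner_le_exp:
  assumes \<delta>: "\<delta> > 0" and a: "((\<lambda>t. V t y) has_vector_derivative a) (at 0)"
    and sympl: "\<And>t. \<bar>t\<bar> < \<delta> \<Longrightarrow> inner x (J (V t y)) = 0"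
  shows "\<bar>inner x y\<bar> \<le> norm x * norm y * exp (- m * \<delta>)"
proof -
  have bound: "cmod (cpair x y) \<le> norm x * norm y * exp (- m * \<delta> * r\<^sup>2)" if r: "0 < r" "r < 1" for r
  proof -
    \<comment> \<open>The first summand meets the size condition of
      \<open>reflected_strip_bound\<close>; adding \<open>\<delta>\<close> makes it strict and puts
      the interval of reality inside the square.\<close>
    define R where "R = 2 * \<delta> / (1 - r\<^sup>2) + \<delta>"
    have "r\<^sup>2 < 1" using r by (simp add: power_less_one_iff)
    then have R: "2 * \<delta> / (1 - r\<^sup>2) < R" "\<delta> \<le> R" "0 < R"
      using \<delta> by (auto simp: R_def add_pos_pos)
    obtain F where F:
      "F holomorphic_on {z. \<bar>Re z\<bar> < R \<and> 0 < Im z \<and> Im z < R}"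
      "continuous_on {z. \<bar>Re z\<bar> < R \<and> 0 \<le> Im z \<and> Im z < R} F"
      "\<And>t. \<bar>t\<bar> \<le> R \<Longrightarrow> F (of_real t) = cpair x (V t y)"
      "\<And>z. \<bar>Re z\<bar> < R \<Longrightarrow> 0 \<le> Im z \<Longrightarrow> Im z < R \<Longrightarrow> cmod (F z) \<le> norm x * norm y * exp (- m * Im z)"
      using orbit_extension[OF R(3) a, of x] by blast
    have "F (of_real t) \<in> \<real>" if "\<bar>t\<bar> < \<delta>" for t
    proof -
      have "F (of_real t) = cpair x (V t y)" using F(3)[of t] that R(2) by simp
      then show ?thesis using sympl[OF that] by (simp add: cpair_def complex_is_Real_iff)
    qed
    from reflected_strip_bound[OF \<delta> m r R(1) _ F(1,2) this F(4)]
    have "cmod (F 0) \<le> norm x * norm y * exp (- m * \<delta> * r\<^sup>2)" by simp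
    then show ?thesis using F(3)[of 0] R(3) by simp
  qed
  \<comment> \<open>A sequence tending to 1 that lies strictly between 0 and 1 from
    \<open>n = 1\<close> on.\<close>
  define r where "r = (\<lambda>n. of_nat n / of_nat (Suc n) :: real)"
  have "\<bar>inner x y\<bar> \<le> cmod (cpair x y)"
    using abs_Re_le_cmod[of "cpair x y"] by (simp add: cpair_def)
  also have "\<dots> \<le> norm x * norm y * exp (- m * \<delta> * 1\<^sup>2)"
  proof (rule tendsto_lowerbound[OF _ _ sequentially_bot])
    show "(\<lambda>n. norm x * norm y * exp (- m * \<delta> * (r n)\<^sup>2)) \<longlonglongrightarrow> norm x * norm y * exp (- m * \<delta> * 1\<^sup>2)"
      unfolding r_def by (intro tendsto_intros LIMSEQ_n_over_Suc_n)
    show "\<forall>\<^sub>F n in sequentially. cmod (cpair x y) \<le> norm x * norm y * exp (- m * \<delta> * (r n)\<^sup>2)"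
      using eventually_ge_at_top[of 1]
      by eventually_elim (rule bound, auto simp: r_def)
  qed
  finally show ?thesis by simp
qed

end

section \<open>Smoothing by averages over short times\<close>

context unitary_flow begin

text \<open>The average lies in the domain of the generator for every \<open>y\<close> and tends to
  \<open>y\<close> as \<open>\<epsilon>\<close> tends to 0; it involves the orbit only up to time
  \<open>\<epsilon>\<close>.\<close>

definition orbit_average :: "real \<Rightarrow> 'a \<Rightarrow> 'a" where
  "orbit_average \<epsilon> y = (1 / \<epsilon>) *\<^sub>R integral {0..\<epsilon>} (\<lambda>u. V u y)"

lemma V_orbit_average: "V t (orbit_average \<epsilon> y) = (1 / \<epsilon>) *\<^sub>R integral {0..\<epsilon>} (\<lambda>u. V (u + t) y)"
proof -
  have "(\<lambda>u. V u y) integrable_on {0..\<epsilon>}"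
    by (intro integrable_continuous_interval continuous_intros)
  from integral_linear[OF this bounded_linear_V[of t]]
  show ?thesis by (simp add: orbit_average_def V.scaleR o_def V_add[symmetric] add.commute)
qed

text \<open>Applying \<open>V t\<close> shifts the averaging interval, so with an antiderivative
  \<open>W\<close> of the orbit the result is
  \<open>(W (t + \<epsilon>) - W t) / \<epsilon>\<close>.\<close>

lemma orbit_average_differentiable:
  assumes "\<epsilon> > 0"
  shows "\<exists>a. ((\<lambda>t. V t (orbit_average \<epsilon> y)) has_vector_derivative a) (at 0)"
proof -
  \<comment> \<open>The margin 1 on both sides keeps \<open>t\<close> and
    \<open>t + \<epsilon>\<close> interior for \<open>\<bar>t\<bar> < 1\<close>.\<close>
  have "continuous_on {-1..\<epsilon> + 1} (\<lambda>u. V u y)" by (intro continuous_intros)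
  then obtain W where W: "\<And>u. u \<in> {-1..\<epsilon> + 1} \<Longrightarrow> (W has_vector_derivative V u y) (at u within {-1..\<epsilon> + 1})"
    by (rule antiderivative_continuous) blast
  have at: "(W has_vector_derivative V u y) (at u)" if "-1 < u" "u < \<epsilon> + 1" for u
    using W[of u] that by (simp add: at_within_Icc_at)
  have eq: "V t (orbit_average \<epsilon> y) = (1 / \<epsilon>) *\<^sub>R (W (t + \<epsilon>) - W t)" if "t \<in> {-1<..<1}" for t
  proof -
    have "((\<lambda>u. V u y) has_integral W (t + \<epsilon>) - W t) {t..t + \<epsilon>}"
      using assms that by (intro fundamental_theorem_of_calculus has_vector_derivative_at_within[OF at]) auto
    then show ?thesis
      unfolding V_orbit_average using integral_shift_real_ivl[of t t "t + \<epsilon>" "\<lambda>u. V u y"]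
      by (simp add: integral_unique)
  qed
  have shift: "((\<lambda>t. t + \<epsilon>) has_vector_derivative 1) (at 0)"
    by (auto intro!: derivative_eq_intros)
  have "(W has_vector_derivative V \<epsilon> y) (at (0 + \<epsilon>))" using at[of \<epsilon>] assms by simp
  from vector_diff_chain_at[OF shift this]
  have "((\<lambda>t. W (t + \<epsilon>)) has_vector_derivative V \<epsilon> y) (at 0)" by (simp add: o_def)
  then have "((\<lambda>t. (1 / \<epsilon>) *\<^sub>R (W (t + \<epsilon>) - W t)) has_vector_derivative (1 / \<epsilon>) *\<^sub>R (V \<epsilon> y - V 0 y)) (at 0)"
    using at[of 0] assms
    by (intro bounded_linear.has_vector_derivative[OF bounded_linear_scaleR_right] has_vector_derivative_diff) auto
  then have "((\<lambda>t. V t (orbit_average \<epsilon> y)) has_vector_derivative (1 / \<epsilon>) *\<^sub>R (V \<epsilon> y - V 0 y)) (at 0)"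
    by (rule has_vector_derivative_transform_within_open[where S = "{-1<..<1}"]) (auto simp: eq)
  then show ?thesis by blast
qed

lemma orbit_average_close:
  assumes \<epsilon>: "\<epsilon> > 0" and close: "\<And>u. 0 \<le> u \<Longrightarrow> u \<le> \<epsilon> \<Longrightarrow> norm (V u y - y) \<le> e"
  shows "norm (orbit_average \<epsilon> y - y) \<le> e"
proof -
  have int: "(\<lambda>u. V u y) integrable_on {0..\<epsilon>}" "(\<lambda>u. V u y - y) integrable_on {0..\<epsilon>}"
    by (intro integrable_continuous_interval continuous_intros)+
  have "integral {0..\<epsilon>} (\<lambda>u. V u y - y) = integral {0..\<epsilon>} (\<lambda>u. V u y) - \<epsilon> *\<^sub>R y"
    using \<epsilon> integral_diff[OF int(1) integrable_const_ivl] by simp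
  then have "orbit_average \<epsilon> y - y = (1 / \<epsilon>) *\<^sub>R integral {0..\<epsilon>} (\<lambda>u. V u y - y)"
    using \<epsilon> by (simp add: orbit_average_def scaleR_diff_right)
  moreover have "norm (integral {0..\<epsilon>} (\<lambda>u. V u y - y)) \<le> integral {0..\<epsilon>} (\<lambda>_. e)"
    using close by (intro integral_norm_bound_integral int(2)) auto
  ultimately show ?thesis using \<epsilon> by (simp add: field_simps)
qed

lemma inner_J_orbit_average:
  assumes "\<And>u. 0 \<le> u \<Longrightarrow> u \<le> \<epsilon> \<Longrightarrow> inner x (J (V (u + t) y)) = 0"
  shows "inner x (J (V t (orbit_average \<epsilon> y))) = 0"
proof -
  have bl: "bounded_linear (\<lambda>v. inner x (J v))"
    by (intro bounded_linear_compose[OF bounded_linear_inner_right] bounded_linear_J)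
  have "(\<lambda>u. V (u + t) y) integrable_on {0..\<epsilon>}"
    by (intro integrable_continuous_interval continuous_intros)
  from integral_linear[OF this bl]
  have "inner x (J (integral {0..\<epsilon>} (\<lambda>u. V (u + t) y))) = integral {0..\<epsilon>} (\<lambda>u. inner x (J (V (u + t) y)))"
    by (simp add: o_def)
  also have "\<dots> = integral {0..\<epsilon>} (\<lambda>u. 0)"
    by (rule integral_cong) (use assms in auto)
  finally show ?thesis by (simp add: V_orbit_average J.scaleR)
qed

end

text \<open>Replacing \<open>y\<close> by its average makes the orbit differentiable but shortens
  the interval of the symplectic condition to \<open>\<delta> - \<epsilon>\<close>; the loss
  disappears as \<open>\<epsilon>\<close> tends to 0.\<close>

lemma (in positive_energy_flow) inner_le_exp:
  assumes \<delta>: "\<delta> > 0" and sympl: "\<And>t. \<bar>t\<bar> \<le> \<delta> \<Longrightarrow> inner x (J (V t y)) = 0"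
  shows "\<bar>inner x y\<bar> \<le> norm x * norm y * exp (- m * \<delta>)"
proof -
  have "isCont (\<lambda>t. V t y) 0"
    using continuous_V continuous_on_eq_continuous_at open_UNIV by blast
  have avg: "\<bar>inner x (orbit_average \<epsilon> y)\<bar> \<le> norm x * norm (orbit_average \<epsilon> y) * exp (- m * (\<delta> - \<epsilon>))"
    if \<epsilon>: "0 < \<epsilon>" "\<epsilon> < \<delta>" for \<epsilon>
  proof -
    obtain a where a: "((\<lambda>t. V t (orbit_average \<epsilon> y)) has_vector_derivative a) (at 0)"
      using orbit_average_differentiable[OF \<epsilon>(1)] by blast
    have "inner x (J (V t (orbit_average \<epsilon> y))) = 0" if "\<bar>t\<bar> < \<delta> - \<epsilon>" for t
      by (rule inner_J_orbit_average) (use that in \<open>auto intro!: sympl\<close>)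
    with \<epsilon> show ?thesis by (intro smooth_inner_le_exp[OF _ a]) auto
  qed
  have lim: "((\<lambda>\<epsilon>. orbit_average \<epsilon> y) \<longlongrightarrow> y) (at_right 0)"
  proof (rule tendstoI)
    fix e :: real assume e: "e > 0"
    obtain \<eta> where \<eta>: "0 < \<eta>" "\<And>v. \<bar>v\<bar> < \<eta> \<Longrightarrow> norm (V v y - y) < e / 2"
      using \<open>isCont (\<lambda>t. V t y) 0\<close> e unfolding continuous_at_eps_delta
      by (metis dist_norm V_0 diff_zero half_gt_zero real_norm_def)
    have "dist (orbit_average \<epsilon> y) y < e" if "0 < \<epsilon>" "\<epsilon> < \<eta>" for \<epsilon>
    proof -
      have "norm (orbit_average \<epsilon> y - y) \<le> e / 2"
        using that \<eta>(2) by (intro orbit_average_close) (auto intro: less_imp_le)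
      then show ?thesis using e by (simp add: dist_norm)
    qed
    then show "\<forall>\<^sub>F \<epsilon> in at_right 0. dist (orbit_average \<epsilon> y) y < e"
      unfolding eventually_at_right_field using \<eta>(1) by blast
  qed
  have "\<bar>inner x y\<bar> \<le> norm x * norm y * exp (- m * (\<delta> - 0))"
  proof (rule tendsto_le)
    show "((\<lambda>\<epsilon>. \<bar>inner x (orbit_average \<epsilon> y)\<bar>) \<longlongrightarrow> \<bar>inner x y\<bar>) (at_right 0)"
      by (intro tendsto_intros lim)
    show "((\<lambda>\<epsilon>. norm x * norm (orbit_average \<epsilon> y) * exp (- m * (\<delta> - \<epsilon>)))
        \<longlongrightarrow> norm x * norm y * exp (- m * (\<delta> - 0))) (at_right 0)"
      by (intro tendsto_intros lim)
    show "\<forall>\<^sub>F \<epsilon> in at_right 0. \<bar>inner x (orbit_average \<epsilon> y)\<bar>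
        \<le> norm x * norm (orbit_average \<epsilon> y) * exp (- m * (\<delta> - \<epsilon>))"
      unfolding eventually_at_right_field using \<delta> avg by blast
  qed simp
  then show ?thesis by simp
qed

section \<open>The angle between the ranges\<close>

text \<open>A type variable of sort \<open>{real_inner, complete_space}\<close> is not known to be of class
  \<open>banach\<close>, on which vector-valued integration rests; this copy of the type is.\<close>

typedef (overloaded) 'a hilb = "UNIV :: 'a::{real_inner,complete_space} set"
  morphisms of_hilb to_hilb by simp

lemma to_hilb_inverse' [simp]: "of_hilb (to_hilb x) = x"
  by (simp add: to_hilb_inverse)

lemma of_hilb_inverse' [simp]: "to_hilb (of_hilb x) = x"
  by (simp add: of_hilb_inverse)

instantiation hilb :: ("{real_inner,complete_space}") real_inner
begin

definition zero_hilb :: "'a hilb" where "0 = to_hilb 0"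
definition plus_hilb :: "'a hilb \<Rightarrow> 'a hilb \<Rightarrow> 'a hilb" where
  "x + y = to_hilb (of_hilb x + of_hilb y)"
definition minus_hilb :: "'a hilb \<Rightarrow> 'a hilb \<Rightarrow> 'a hilb" where
  "x - y = to_hilb (of_hilb x - of_hilb y)"
definition uminus_hilb :: "'a hilb \<Rightarrow> 'a hilb" where "- x = to_hilb (- of_hilb x)"
definition scaleR_hilb :: "real \<Rightarrow> 'a hilb \<Rightarrow> 'a hilb" where
  "scaleR r x = to_hilb (r *\<^sub>R of_hilb x)"
definition inner_hilb :: "'a hilb \<Rightarrow> 'a hilb \<Rightarrow> real" where
  "inner x y = inner (of_hilb x) (of_hilb y)"
definition norm_hilb :: "'a hilb \<Rightarrow> real" where "norm x = norm (of_hilb x)"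
definition sgn_hilb :: "'a hilb \<Rightarrow> 'a hilb" where "sgn x = to_hilb (sgn (of_hilb x))"
definition dist_hilb :: "'a hilb \<Rightarrow> 'a hilb \<Rightarrow> real" where
  "dist x y = norm (of_hilb x - of_hilb y)"
definition uniformity_hilb :: "('a hilb \<times> 'a hilb) filter" where
  "uniformity = (INF e\<in>{0 <..}. principal {(x :: 'a hilb, y). dist x y < e})"
definition open_hilb :: "'a hilb set \<Rightarrow> bool" where
  "open U \<longleftrightarrow> (\<forall>x\<in>U. eventually (\<lambda>(x' :: 'a hilb, y). x' = x \<longrightarrow> y \<in> U) uniformity)"

instance
proof
  fix x :: "'a hilb"
  show "inner x x = 0 \<longleftrightarrow> x = 0"
    by (metis inner_eq_zero_iff inner_hilb_def of_hilb_inverse' to_hilb_inverse' zero_hilb_def)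
qed (simp_all add: zero_hilb_def plus_hilb_def minus_hilb_def uminus_hilb_def scaleR_hilb_def
    inner_hilb_def norm_hilb_def sgn_hilb_def dist_hilb_def uniformity_hilb_def open_hilb_def
    algebra_simps inner_commute norm_eq_sqrt_inner sgn_div_norm)

end

lemma norm_of_hilb [simp]: "norm (of_hilb x) = norm x"
  by (simp add: norm_hilb_def)

lemma norm_to_hilb [simp]: "norm (to_hilb x) = norm x"
  by (simp add: norm_hilb_def)

lemma inner_to_hilb [simp]: "inner (to_hilb x) (to_hilb y) = inner x y"
  by (simp add: inner_hilb_def)

lemma bounded_linear_of_hilb: "bounded_linear of_hilb"
  by (rule bounded_linear_intro[of _ 1]) (simp_all add: plus_hilb_def scaleR_hilb_def)

lemma bounded_linear_to_hilb: "bounded_linear to_hilb"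
  by (rule bounded_linear_intro[of _ 1]) (simp_all add: plus_hilb_def scaleR_hilb_def)

instance hilb :: ("{real_inner,complete_space}") complete_space
proof
  fix X :: "nat \<Rightarrow> 'a hilb"
  assume "Cauchy X"
  then have "Cauchy (\<lambda>n. of_hilb (X n))"
    by (rule bounded_linear.Cauchy[OF bounded_linear_of_hilb])
  then obtain l where "(\<lambda>n. of_hilb (X n)) \<longlonglongrightarrow> l"
    using Cauchy_convergent_iff convergent_def by blast
  then have "(\<lambda>n. to_hilb (of_hilb (X n))) \<longlonglongrightarrow> to_hilb l"
    by (rule bounded_linear.tendsto[OF bounded_linear_to_hilb])
  then show "convergent X"
    by (auto simp: convergent_def)
qed

instance hilb :: ("{real_inner,complete_space}") banach ..

text \<open>The isometric bijection \<open>to_hilb\<close> conjugates \<open>J\<close> and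
  \<open>V\<close> to a positive energy flow on the copy and preserves inner products, so the bound
  transfers back.\<close>

lemma symplectic_orbit_inner_le:
  fixes J :: "'a::{real_inner,complete_space} \<Rightarrow> 'a"
  assumes J: "complex_structure J" and V: "unitary_group J V" and m: "m > 0"
    and gen: "generator_bounded_below J V m" and \<delta>: "\<delta> > 0"
    and sympl: "\<And>t. \<bar>t\<bar> \<le> \<delta> \<Longrightarrow> inner x (J (V t y)) = 0"
  shows "\<bar>inner x y\<bar> \<le> norm x * norm y * exp (- m * \<delta>)"
proof -
  define J' where "J' = (\<lambda>x. to_hilb (J (of_hilb x)))"
  define V' where "V' = (\<lambda>t x. to_hilb (V t (of_hilb x)))"
  have conj: "bounded_linear (\<lambda>x. to_hilb (f (of_hilb x)))" if "bounded_linear f" for f :: "'a \<Rightarrow> 'a"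
    using that by (intro bounded_linear_compose[OF bounded_linear_to_hilb]
        bounded_linear_compose[of f, OF _ bounded_linear_of_hilb])
  have J': "complex_structure J'"
    using J unfolding complex_structure_def J'_def
    by (auto intro: conj simp: inner_hilb_def uminus_hilb_def)
  have "surj (V' t)" for t
  proof (rule surjI)
    fix x
    have "surj (V t)" using V by (simp add: unitary_group_def)
    then show "V' t (to_hilb (inv (V t) (of_hilb x))) = x"
      by (simp add: V'_def surj_f_inv_f)
  qed
  moreover have "continuous_on UNIV (\<lambda>t. V' t x)" for x
    unfolding V'_def using V
    by (intro bounded_linear.continuous_on[OF bounded_linear_to_hilb]) (simp add: unitary_group_def)
  ultimately have V': "unitary_group J' V'"
    using V unfolding unitary_group_def
    by (auto intro: conj simp: V'_def J'_def fun_eq_iff)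
  have gen': "generator_bounded_below J' V' m"
    unfolding generator_bounded_below_def
  proof (intro allI impI)
    fix x d assume "((\<lambda>t. V' t x) has_vector_derivative d) (at 0)"
    then have "((\<lambda>t. of_hilb (V' t x)) has_vector_derivative of_hilb d) (at 0)"
      by (rule bounded_linear.has_vector_derivative[OF bounded_linear_of_hilb])
    then have "((\<lambda>t. V t (of_hilb x)) has_vector_derivative of_hilb d) (at 0)"
      by (simp add: V'_def)
    then have "m * (norm (of_hilb x))\<^sup>2 \<le> inner (of_hilb x) (- J (of_hilb d))"
      using gen unfolding generator_bounded_below_def by blast
    then show "m * (norm x)\<^sup>2 \<le> inner x (- J' d)"
      by (simp add: inner_hilb_def J'_def uminus_hilb_def)
  qed
  interpret positive_energy_flow J' V' m
    by unfold_locales (fact J' V' m gen')+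
  have "\<bar>inner (to_hilb x) (to_hilb y)\<bar> \<le> norm (to_hilb x) * norm (to_hilb y) * exp (- m * \<delta>)"
    by (rule inner_le_exp[OF \<delta>]) (simp add: J'_def V'_def sympl)
  then show ?thesis by simp
qed

text \<open>\<open>V t\<close> preserves inner products and commutes with \<open>J\<close>, so it
  cancels from the pairing. What remains is \<open>inner v (J y) + inner (J v) y\<close>, which
  vanishes because \<open>J\<close> is skew.\<close>

lemma range_conjugated_sympl_compl:
  assumes J: "complex_structure J" and F: "real_proj F" and V: "unitary_group J V"
    and x: "x \<in> range (V t \<circ> sympl_compl J F \<circ> V (-t))" and y: "y \<in> range F"
  shows "inner x (J (V t y)) = 0"
proof -
  have JJ: "J (J z) = - z" and inJ: "inner (J z) (J w) = inner z w" and lJ: "bounded_linear J" for z w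
    using J by (auto simp: complex_structure_def)
  have lV: "bounded_linear (V t)" and nV: "norm (V t z) = norm z" and VJ: "V t (J z) = J (V t z)" for z
    using V by (auto simp: unitary_group_def)
  interpret V: bounded_linear "V t" by (rule lV)
  interpret J: bounded_linear J by (rule lJ)
  \<comment> \<open>Polarization: a linear isometry preserves the inner product.\<close>
  have inV: "inner (V t z) (V t w) = inner z w" for z w
  proof -
    have "(norm (V t (z + w)))\<^sup>2 = (norm (z + w))\<^sup>2" "(norm (V t z))\<^sup>2 = (norm z)\<^sup>2" "(norm (V t w))\<^sup>2 = (norm w)\<^sup>2"
      by (simp_all add: nV)
    then show ?thesis
      by (simp add: power2_norm_eq_inner V.add inner_add_left inner_add_right inner_commute)
  qed
  obtain v where v: "x = V t (v + J (F (J v)))"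
    using x by (auto simp: sympl_compl_def)
  have Fy: "F y = y" using real_proj_fixes[OF F y] .
  have "inner x (J (V t y)) = inner (v + J (F (J v))) (J y)"
    by (simp add: v inV flip: VJ)
  also have "\<dots> = inner v (J y) + inner (F (J v)) y"
    by (simp add: inner_add_left inJ)
  also have "inner (F (J v)) y = inner (J v) y"
    using real_projD(3)[OF F, of "J v" y] Fy by simp
  also have "inner (J v) y = - inner v (J y)"
    using inJ[of "J v" y] by (simp add: JJ)
  finally show ?thesis by simp
qed

theorem theorem5p6:
  fixes J :: "'a::{real_inner, complete_space} \<Rightarrow> 'a"
    and E F :: "'a \<Rightarrow> 'a"
    and V :: "real \<Rightarrow> 'a \<Rightarrow> 'a"
    and m \<delta> :: real
  assumes "complex_structure J"
    and "real_proj E" and "real_proj F"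
    and "unitary_group J V"
    and "m > 0" and "generator_bounded_below J V m"
    and "\<delta> > 0"
    and "\<forall>t\<in>{-\<delta>..\<delta>}. proj_le E (V t \<circ> sympl_compl J F \<circ> V (-t))"
  shows "onorm (\<lambda>x. E (F x)) \<le> exp (- m * \<delta>)
         \<and> proj_meet E F = (\<lambda>_. 0)
         \<and> onorm (\<lambda>x. E x + F x - proj_join E F x) \<le> exp (- m * \<delta>)"
proof -
  define q where "q = exp (- m * \<delta>)"
  have q: "0 \<le> q" "q < 1" using assms(5,7) by (auto simp: q_def)
  \<comment> \<open>Claims (a), (b) and (c) all follow from this bound on the angle;
    \<open>q < 1\<close> is strict because \<open>m\<close> and \<open>\<delta>\<close> are
    positive.\<close>
  have angle: "\<bar>inner x y\<bar> \<le> q * norm x * norm y" if x: "x \<in> range E" and y: "y \<in> range F" for x y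
  proof -
    have "inner x (J (V t y)) = 0" if "\<bar>t\<bar> \<le> \<delta>" for t
    proof (rule range_conjugated_sympl_compl[OF assms(1,3,4) _ y])
      have "t \<in> {-\<delta>..\<delta>}" using that by auto
      then show "x \<in> range (V t \<circ> sympl_compl J F \<circ> V (-t))"
        using assms(8) x unfolding proj_le_def by blast
    qed
    from symplectic_orbit_inner_le[OF assms(1,4,5,6,7) this]
    show ?thesis by (simp add: q_def mult_ac)
  qed
  have "onorm (\<lambda>x. E (F x)) \<le> q"
  proof (rule onorm_bound[OF q(1)])
    fix x
    have "norm (E (F x)) \<le> q * norm (F x)"
      by (rule real_proj_compose_norm_le[OF assms(2,3) q(1) angle])
    also have "\<dots> \<le> q * norm x"
      using real_proj_norm_le[OF assms(3)] q(1) by (rule mult_left_mono)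
    finally show "norm (E (F x)) \<le> q * norm x" .
  qed
  moreover have "proj_meet E F = (\<lambda>_. 0)"
    by (rule proj_meet_eq_zero[OF assms(2,3) q(2) angle])
  moreover have "onorm (\<lambda>x. E x + F x - proj_join E F x) \<le> q"
    by (rule onorm_bound[OF q(1) proj_join_norm_le[OF assms(2,3) q angle]])
  ultimately show ?thesis by (simp add: q_def)
qed

end
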